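(* Let $d\ge2$ be an integer and let $a \in \mathbb{R}^d$ satisfy $\bar a_k>0$ for $k=2,\dots,d$. Put $r=-\bar a_1$ and, for integers $0\le j\le k$ and $m\in\mathbb{N}_0^d(j)$, set $$w_m^{r,j,k} = C^{-1}\binom{r}{k}\binom{k}{j}(-1)^{k-j}d^{\,r-j}\binom{j}{m_1,\dots,m_d}\prod_{i=2}^d \frac{\bar a_i}{\bar a_i + \bar m_i},\qquad C = \mathbb{E}_{a+re_1}\left[\frac{1}{Y_1^r}\right],$$ where $C$ is given explicitly by $$C= \sum_{k=0}^\infty \binom{r}{k} \sum_{j=0}^k \binom{k}{j} (-1)^{k-j}d^{\,r-j}\sum_{m \in \mathbb{N}_0^d(j)}\binom{j}{m_1,\dots,m_d} \prod_{i=2}^d \frac{\bar a_i}{\bar a_i + \bar m_i}.$$ Then: 1. the moment generating function of the log gaps $Z_2,\dots,Z_d$ is given by $$\mathbb{E}_a\left[e^{t_2Z_2 + \dots + t_dZ_d}\right] = \sum_{k=0}^\infty \sum_{j=0}^k\sum_{m \in \mathbb{N}_0^d(j)} w_m^{r,j,k} \prod_{i=2}^d \frac{\bar a_i+\bar m_i}{\bar a_i - t_i + \bar m_i}$$ for all real $t_2,\dots,t_d$ with $t_i < \bar a_i$ for $i =2,\dots,d$; 2. for any $n = (n_2,\dots,n_d) \in \mathbb{N}_0^{d-1}$, $$\mathbb{E}_a\left[\prod_{k=2}^d Z_k^{n_k}\right] = \sum_{k=0}^\infty \sum_{j=0}^k\sum_{m \in \mathbb{N}_0^d(j)} w_m^{r,j,k}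 \prod_{i=2}^d \frac{n_i!}{(\bar a_i + \bar m_i)^{n_i}}.$$
   Context: For a vector $v \in \mathbb{R}^d$, write $\bar v_k := v_k + v_{k+1} + \dots + v_d$ for its tail sums, $k=1,\dots,d$; $e_1,\dots,e_d$ is the standard basis of $\mathbb{R}^d$. $\mathbb{N}_0 = \{0,1,2,\dots\}$, and for an integer $j \ge 0$, $\mathbb{N}_0^d(j) = \{m \in \mathbb{N}_0^d : \bar m_1 = j\}$ (so $\mathbb{N}_0^d(0)=\{0\}$). For $m\in\mathbb{N}_0^d(j)$, $\binom{j}{m_1,\dots,m_d} = \frac{j!}{m_1!\cdots m_d!}$. For $r\in\mathbb{R}$ and $k\in\mathbb{N}_0$, $\binom{r}{k} = \frac{r(r-1)\cdots(r-k+1)}{k!}$ is the generalized binomial coefficient. The ordered simplex is $\nabla^{d-1} = \{y \in \mathbb{R}^d: y_1 \geq y_2\geq \dots \geq y_d \geq 0,\ y_1+\dots+y_d = 1\}$. Integrals $dy$ over $\nabla^{d-1}$ are with respect to the pushforward of Lebesgue measure on $\mathbb{R}^{d-1}$ under $(y_1,\dots,y_{d-1}) \mapsto (y_1,\dots,y_{d-1},1-y_1-\dots-y_{d-1})$. For $a \in \mathbb{R}^d$ with $\bar a_k>0$ for $k=2,\dots,d$, the constant $Q_a = \int_{\nabla^{d-1}}\prod_{k=1}^d y_k^{a_k-1}\,dy$ is finite (known fact), and the Generalized Rank Dirichlet distribution GRD$(a)$ is the probability measure $\mathbb{P}_a(A) = Q_a^{-1}\int_{\nabla^{d-1}} \prod_{k=1}^d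 y_k^{a_k-1} 1_A(y)\,dy$ on Borel subsets $A$ of $\nabla^{d-1}$. $\mathbb{E}_a$ denotes expectation under $\mathbb{P}_a$, and $Y=(Y_1,\dots,Y_d)$ is a random vector with law $\mathbb{P}_a$ under $\mathbb{P}_a$ (e.g. the identity map on $\nabla^{d-1}$). The log gaps are $Z_k = \log Y_{k-1} - \log Y_k$ for $k=2,\dots,d$ (almost surely well defined since $Y_d>0$ almost surely). The series over $k$ is understood as an iterated sum: for each $k$ the inner sums over $j$ and $m$ are finite. *)

theory Defs
  imports "HOL-Probability.Probability"
begin

(* A vector in R^d is a function on nat of which only the entries 1, ..., d matter.
   Points of a measure space and multi-indices are extensional functions on {1..d};
   the Borel sigma-algebra of R^d is the product sigma-algebra. *)

definition tail_sum :: "nat \<Rightarrow> (nat \<Rightarrow> 'a::comm_monoid_add) \<Rightarrow> nat \<Rightarrow> 'a" where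
  "tail_sum d v k = (\<Sum>i=k..d. v i)"

definition multi_indices :: "nat \<Rightarrow> nat \<Rightarrow> (nat \<Rightarrow> nat) set" where
  "multi_indices d j = {m \<in> {1..d} \<rightarrow>\<^sub>E UNIV. tail_sum d m 1 = j}"

definition multinomial :: "nat \<Rightarrow> nat \<Rightarrow> (nat \<Rightarrow> nat) \<Rightarrow> real" where
  "multinomial d j m = fact j / (\<Prod>i=1..d. fact (m i))"

definition ordered_simplex :: "nat \<Rightarrow> (nat \<Rightarrow> real) set" where
  "ordered_simplex d = {y \<in> extensional {1..d}.
     (\<forall>k\<in>{1..<d}. y k \<ge> y (Suc k)) \<and> y d \<ge> 0 \<and> (\<Sum>k=1..d. y k) = 1}"

definition hyperplane_lebesgue :: "nat \<Rightarrow> (nat \<Rightarrow> real) measure" where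
  "hyperplane_lebesgue d =
     distr (Pi\<^sub>M {1..<d} (\<lambda>_. lborel)) (Pi\<^sub>M {1..d} (\<lambda>_. borel))
       (\<lambda>y. \<lambda>i\<in>{1..d}. if i < d then y i else 1 - (\<Sum>k\<in>{1..<d}. y k))"

definition simplex_lebesgue :: "nat \<Rightarrow> (nat \<Rightarrow> real) measure" where
  "simplex_lebesgue d = restrict_space (hyperplane_lebesgue d) (ordered_simplex d)"

(* The conventions 0 powr x = 0 and (for the log gaps below) ln 0 = 0 only affect the null set of y with y d = 0. *)
definition GRD_weight :: "nat \<Rightarrow> (nat \<Rightarrow> real) \<Rightarrow> (nat \<Rightarrow> real) \<Rightarrow> ennreal" where
  "GRD_weight d a y = ennreal (\<Prod>k=1..d. y k powr (a k - 1))"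

definition GRD_const :: "nat \<Rightarrow> (nat \<Rightarrow> real) \<Rightarrow> ennreal" where
  "GRD_const d a = (\<integral>\<^sup>+ y. GRD_weight d a y \<partial>simplex_lebesgue d)"

definition GRD :: "nat \<Rightarrow> (nat \<Rightarrow> real) \<Rightarrow> (nat \<Rightarrow> real) measure" where
  "GRD d a = density (simplex_lebesgue d) (\<lambda>y. GRD_weight d a y / GRD_const d a)"

definition log_gap :: "nat \<Rightarrow> (nat \<Rightarrow> real) \<Rightarrow> real" where
  "log_gap k y = ln (y (k - 1)) - ln (y k)"

(* a(1 := a 1 + r) is the parameter vector a + r e_1. *)
definition mixture_const :: "nat \<Rightarrow> (nat \<Rightarrow> real) \<Rightarrow> real \<Rightarrow> real" where
  "mixture_const d a r =
     prob_space.expectation (GRD d (a(1 := a 1 + r))) (\<lambda>y. 1 / y 1 powr r)"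

definition mixture_weight ::
    "nat \<Rightarrow> (nat \<Rightarrow> real) \<Rightarrow> real \<Rightarrow> nat \<Rightarrow> nat \<Rightarrow> (nat \<Rightarrow> nat) \<Rightarrow> real" where
  "mixture_weight d a r j k m =
     inverse (mixture_const d a r) * (r gchoose k) * real (k choose j) * (-1) ^ (k - j)
       * real d powr (r - real j) * multinomial d j m
       * (\<Prod>i=2..d. tail_sum d a i / (tail_sum d a i + real (tail_sum d m i)))"

end

theory Submission
  imports Defs
begin

text \<open>
  Write the ordered point as \<open>Y\<^sub>k = e\<^bsup>-(Z\<^sub>2+\<dots>+Z\<^sub>k)\<^esup> / S\<close> with
  \<open>S = \<Sum>\<^sub>k e\<^bsup>-(Z\<^sub>2+\<dots>+Z\<^sub>k)\<^esup>\<close>. In the log gap coordinates Lebesgue measure on the simplex becomes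
  \<open>\<Prod>\<^sub>k y\<^sub>k dz\<close>, so the GRD weight turns into \<open>S\<^bsup>r\<^esup>\<close> times a product of exponential densities
  with rates given by the tail sums of \<open>a\<close>; the parameter \<open>a + r e\<^sub>1\<close> removes the factor \<open>S\<^bsup>r\<^esup>\<close>.
  Almost surely \<open>1 \<le> S \<le> d\<close>, so the binomial series of \<open>S\<^bsup>r\<^esup> = (d + (S - d))\<^bsup>r\<^esup>\<close> converges uniformly
  and may be integrated term by term; the powers of \<open>S\<close> are expanded by the multinomial theorem, and
  each resulting term factorises into one-dimensional Gamma integrals.
\<close>

section \<open>Exponential substitutions\<close>

text \<open>Write abar_i for \<open>tail_sum d a i\<close>. The largest coordinate is Y_1 = 1 / S,
  so powers of 1 / Y_1 are powers of S; this is how the constant C = E[S^r] arises. The exponent is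
  r = -abar_1 because the product of the y_k^(a_k) is homogeneous of degree abar_1.

  The binomial series is centred at d, the upper bound of S, because |S - d| <= d - 1 stays strictly
  below the radius of convergence d. Centring at 1 would require |S - 1| < 1, which fails with
  positive probability for d >= 3.

  The order of summation is essential. Expanding (S - d)^k into powers of S gives terms of total
  absolute size (S + d)^k, beyond the radius of convergence, so unless r is a nonnegative integer
  the triple series is not absolutely convergent. Hence each block of fixed k is kept together and
  only its finite inner sums are rearranged.

  Changes of variables are made for nonnegative functions, where Fubini and monotone convergence ask
  for no integrability; signed integrands enter only after the laws have been identified.\<close>

lemma nn_integral_exp_substitution:
  fixes f :: "real \<Rightarrow> ennreal"
  assumes [measurable]: "f \<in> borel_measurable borel" and c: "c > 0"
  shows "(\<integral>\<^sup>+x. f x * indicator {0<..} x \<partial>lborel) = (\<integral>\<^sup>+z. f (c * exp (- z)) * ennreal (c * exp (- z)) \<partial>lborel)"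
proof -
  \<comment> \<open>The substitution uses the increasing map sending w to c e^w on compact
    intervals, as \<open>nn_integral_substitution_aux\<close> asks for a nonnegative derivative; the
    reflection z = -w comes last. The sets \<open>A n\<close> are the images of [-(n+1), n+1], an
    interval of positive length even for n = 0.\<close>
  define u where "u w = f (c * exp w) * ennreal (c * exp w)" for w
  have [measurable]: "u \<in> borel_measurable borel" unfolding u_def by measurable
  define A where "A n = {c * exp (- real (Suc n))..c * exp (real (Suc n))}" for n
  have "(\<lambda>n. \<integral>\<^sup>+x. f x * indicator (A n) x \<partial>lborel) \<longlonglongrightarrow> (\<integral>\<^sup>+x. f x * indicator {0<..} x \<partial>lborel)"
  proof (rule nn_integral_LIMSEQ)
    have "A n \<subseteq> A (Suc n)" for n unfolding A_def using c by auto
    then show "incseq (\<lambda>n x. f x * indicator (A n) x)"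
      by (intro incseq_SucI le_funI mult_left_mono) (auto simp: indicator_def)
    show "(\<lambda>n. f x * indicator (A n) x) \<longlonglongrightarrow> f x * indicator {0<..} x" for x
    proof (cases "x > 0")
      case True
      have "eventually (\<lambda>n. real n \<ge> \<bar>ln (x / c)\<bar>) sequentially"
        by (rule eventually_sequentiallyI[of "nat \<lceil>\<bar>ln (x/c)\<bar>\<rceil>"]) linarith
      then have "eventually (\<lambda>n. x \<in> A n) sequentially"
      proof eventually_elim
        case (elim n)
        have "- real (Suc n) \<le> ln (x/c)" "ln (x/c) \<le> real (Suc n)" using elim by auto
        then have "exp (- real (Suc n)) \<le> x / c" "x / c \<le> exp (real (Suc n))"
          using True c by (metis divide_pos_pos exp_le_cancel_iff exp_ln)+
        then show ?case unfolding A_def using c by (simp add: field_simps)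
      qed
      then have "eventually (\<lambda>n. f x * indicator (A n) x = f x * indicator {0<..} x) sequentially"
        by eventually_elim (use True in simp)
      then show ?thesis by (rule tendsto_eventually)
    next
      case False
      then have "x \<notin> A n" for n unfolding A_def using c by (smt (verit) atLeastAtMost_iff exp_gt_zero mult_pos_pos)
      then show ?thesis using False by simp
    qed
  qed (auto simp: A_def)
  moreover have "(\<lambda>n. \<integral>\<^sup>+w. u w * indicator {- real (Suc n)..real (Suc n)} w \<partial>lborel) \<longlonglongrightarrow> (\<integral>\<^sup>+w. u w \<partial>lborel)"
  proof (rule nn_integral_LIMSEQ)
    show "incseq (\<lambda>n x. u x * indicator {- real (Suc n)..real (Suc n)} x)"
      by (intro incseq_SucI le_funI mult_left_mono) (auto simp: indicator_def)
    show "(\<lambda>n. u x * indicator {- real (Suc n)..real (Suc n)} x) \<longlonglongrightarrow> u x" for x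
    proof -
      have "eventually (\<lambda>n. real n \<ge> \<bar>x\<bar>) sequentially"
        by (rule eventually_sequentiallyI[of "nat \<lceil>\<bar>x\<bar>\<rceil>"]) linarith
      then have "eventually (\<lambda>n. u x * indicator {- real (Suc n)..real (Suc n)} x = u x) sequentially"
        by eventually_elim (auto simp: indicator_def)
      then show ?thesis by (rule tendsto_eventually)
    qed
  qed auto
  moreover have "(\<integral>\<^sup>+x. f x * indicator (A n) x \<partial>lborel)
      = (\<integral>\<^sup>+w. u w * indicator {- real (Suc n)..real (Suc n)} w \<partial>lborel)" for n
    unfolding A_def u_def
    by (subst nn_integral_substitution_aux[where g="\<lambda>w. c * exp w" and g'="\<lambda>w. c * exp w"])
       (use c in \<open>auto intro!: derivative_eq_intros continuous_intros\<close>)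
  ultimately have "(\<integral>\<^sup>+x. f x * indicator {0<..} x \<partial>lborel) = (\<integral>\<^sup>+w. u w \<partial>lborel)"
    using LIMSEQ_unique by fastforce
  also have "\<dots> = (\<integral>\<^sup>+z. u (- z) \<partial>lborel)"
    using nn_integral_real_affine[of u "-1" 0] by simp
  finally show ?thesis by (simp add: u_def)
qed

lemma measurable_fun_upd_PiM_lborel:
  assumes f: "f \<in> borel_measurable (Pi\<^sub>M (insert i I) (\<lambda>_. lborel :: real measure))"
    and x: "x \<in> space (Pi\<^sub>M I (\<lambda>_. lborel :: real measure))" and i: "i \<notin> I"
  shows "(\<lambda>v. f (x(i := v))) \<in> borel_measurable borel"
  using measurable_comp[OF measurable_component_update f, OF x i]
  by (simp only: comp_def measurable_lborel2)

text \<open>Source of the factor s^(d-1) in integration along rays. The coordinates are stretched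
  one at a time, each contributing a factor s.\<close>

lemma nn_integral_PiM_lborel_scale:
  fixes f :: "(nat \<Rightarrow> real) \<Rightarrow> ennreal"
  assumes "finite I" "f \<in> borel_measurable (Pi\<^sub>M I (\<lambda>_. lborel))" "s > 0"
  shows "(\<integral>\<^sup>+x. f x \<partial>Pi\<^sub>M I (\<lambda>_. lborel))
    = ennreal (s ^ card I) * (\<integral>\<^sup>+y. f (\<lambda>i\<in>I. s * y i) \<partial>Pi\<^sub>M I (\<lambda>_. lborel))"
  using assms(1,2)
proof (induction I arbitrary: f rule: finite_induct)
  case empty
  interpret product_sigma_finite "\<lambda>_::nat. lborel :: real measure" ..
  show ?case by (simp add: PiM_empty nn_integral_count_space_finite)
next
  case (insert i I)
  interpret product_sigma_finite "\<lambda>_::nat. lborel :: real measure" ..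
  note [measurable] = insert.prems
  have "(\<integral>\<^sup>+x. f x \<partial>Pi\<^sub>M (insert i I) (\<lambda>_. lborel)) = (\<integral>\<^sup>+ x. (\<integral>\<^sup>+ v. f (x(i := v)) \<partial>lborel) \<partial>Pi\<^sub>M I (\<lambda>_. lborel))"
    by (rule product_nn_integral_insert) (use insert in auto)
  also have "\<dots> = (\<integral>\<^sup>+ x. ennreal s * (\<integral>\<^sup>+ v. f (x(i := s * v)) \<partial>lborel) \<partial>Pi\<^sub>M I (\<lambda>_. lborel))"
  proof (rule nn_integral_cong)
    fix x assume x: "x \<in> space (Pi\<^sub>M I (\<lambda>_. lborel :: real measure))"
    have [measurable]: "(\<lambda>v. f (x(i := v))) \<in> borel_measurable borel"
      using insert.prems x insert.hyps(2) by (rule measurable_fun_upd_PiM_lborel)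
    show "(\<integral>\<^sup>+ v. f (x(i := v)) \<partial>lborel) = ennreal s * (\<integral>\<^sup>+ v. f (x(i := s * v)) \<partial>lborel)"
      using nn_integral_real_affine[of "\<lambda>v. f (x(i := v))" s 0] \<open>s > 0\<close> by simp
  qed
  also have "\<dots> = ennreal s * (\<integral>\<^sup>+ x. (\<integral>\<^sup>+ v. f (x(i := s * v)) \<partial>lborel) \<partial>Pi\<^sub>M I (\<lambda>_. lborel))"
    by (rule nn_integral_cmult) measurable
  also have "(\<integral>\<^sup>+ x. (\<integral>\<^sup>+ v. f (x(i := s * v)) \<partial>lborel) \<partial>Pi\<^sub>M I (\<lambda>_. lborel))
     = ennreal (s ^ card I) * (\<integral>\<^sup>+ x. (\<integral>\<^sup>+ v. f ((\<lambda>j\<in>I. s * x j)(i := s * v)) \<partial>lborel) \<partial>Pi\<^sub>M I (\<lambda>_. lborel))"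
    by (rule insert.IH) measurable
  also have "(\<integral>\<^sup>+ x. (\<integral>\<^sup>+ v. f ((\<lambda>j\<in>I. s * x j)(i := s * v)) \<partial>lborel) \<partial>Pi\<^sub>M I (\<lambda>_. lborel))
     = (\<integral>\<^sup>+ x. (\<integral>\<^sup>+ v. f (\<lambda>j\<in>insert i I. s * (x(i := v)) j) \<partial>lborel) \<partial>Pi\<^sub>M I (\<lambda>_. lborel))"
    using insert.hyps by (intro nn_integral_cong arg_cong[where f=f]) (auto simp: fun_eq_iff)
  also have "\<dots> = (\<integral>\<^sup>+y. f (\<lambda>i\<in>insert i I. s * y i) \<partial>Pi\<^sub>M (insert i I) (\<lambda>_. lborel))"
    by (rule product_nn_integral_insert[symmetric]) (use insert in auto)
  finally show ?case
    using insert.hyps \<open>s > 0\<close> by (simp add: ennreal_mult mult.assoc del: restrict_apply)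
qed

lemma measurable_cumulative_exp_substitution:
  fixes f :: "(nat \<Rightarrow> real) \<Rightarrow> ennreal"
  assumes f: "f \<in> borel_measurable (Pi\<^sub>M {1..d} (\<lambda>_. lborel))"
  shows "(\<lambda>z. f (\<lambda>k\<in>{1..d}. exp (- (\<Sum>i=1..k. z i))) * (\<Prod>k=1..d. ennreal (exp (- (\<Sum>i=1..k. z i)))))
    \<in> borel_measurable (Pi\<^sub>M {1..d} (\<lambda>_. lborel))"
proof -
  have "(\<lambda>z. \<lambda>k\<in>{1..d}. exp (- (\<Sum>i=1..k. z i)) :: real) \<in> Pi\<^sub>M {1..d} (\<lambda>_. lborel) \<rightarrow>\<^sub>M Pi\<^sub>M {1..d} (\<lambda>_. lborel)"
    by (rule measurable_restrict)
       (auto intro!: borel_measurable_exp borel_measurable_uminus borel_measurable_sum simp: measurable_lborel1)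
  from measurable_compose[OF this f] show ?thesis
    by (intro borel_measurable_times_ennreal borel_measurable_prod_ennreal
        measurable_compose[OF _ measurable_ennreal] borel_measurable_exp borel_measurable_uminus borel_measurable_sum) auto
qed

text \<open>The map is triangular: each coordinate is the preceding one times e^(-z_k). With the
  earlier coordinates fixed, the last one is a one-variable exponential substitution whose scale c
  is the preceding coordinate, and the Jacobians accumulate to the product of the x_k. The image is
  the positive orthant, hence the indicators.\<close>

lemma nn_integral_cumulative_exp_substitution:
  fixes f :: "(nat \<Rightarrow> real) \<Rightarrow> ennreal"
  assumes "f \<in> borel_measurable (Pi\<^sub>M {1..d} (\<lambda>_. lborel))"
  shows "(\<integral>\<^sup>+x. f x * (\<Prod>k=1..d. indicator {0<..} (x k)) \<partial>Pi\<^sub>M {1..d} (\<lambda>_. lborel))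
    = (\<integral>\<^sup>+z. f (\<lambda>k\<in>{1..d}. exp (- (\<Sum>i=1..k. z i))) * (\<Prod>k=1..d. ennreal (exp (- (\<Sum>i=1..k. z i)))) 
        \<partial>Pi\<^sub>M {1..d} (\<lambda>_. lborel))"
  using assms
proof (induction d arbitrary: f)
  case 0
  show ?case by (simp add: PiM_empty nn_integral_count_space_finite)
next
  case (Suc d)
  interpret product_sigma_finite "\<lambda>_::nat. lborel :: real measure" ..
  have I: "{1..Suc d} = insert (Suc d) {1..d}" by auto
  let ?P = "Pi\<^sub>M {1..d} (\<lambda>_. lborel :: real measure)"
  let ?e = "\<lambda>z k. exp (- (\<Sum>i=1..k. z i)) :: real"
  note fm[measurable] = Suc.prems[unfolded I]
  \<comment> \<open>The new coordinate is integrated out first, so that the induction hypothesis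
    applies to a function of the old ones.\<close>
  define h where "h x = (\<integral>\<^sup>+ v. f (x(Suc d := v)) * indicator {0<..} v \<partial>lborel)" for x
  have hm[measurable]: "h \<in> borel_measurable ?P" unfolding h_def by measurable
  have "(\<integral>\<^sup>+x. f x * (\<Prod>k=1..Suc d. indicator {0<..} (x k)) \<partial>Pi\<^sub>M {1..Suc d} (\<lambda>_. lborel))
    = (\<integral>\<^sup>+ x. (\<integral>\<^sup>+ v. f (x(Suc d := v)) * (\<Prod>k=1..Suc d. indicator {0<..} ((x(Suc d := v)) k)) \<partial>lborel) \<partial>?P)"
    unfolding I by (rule product_nn_integral_insert, simp, simp) measurable
  also have "\<dots> = (\<integral>\<^sup>+ x. h x * (\<Prod>k=1..d. indicator {0<..} (x k)) \<partial>?P)"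
  proof (rule nn_integral_cong)
    fix x assume x: "x \<in> space ?P"
    have [measurable]: "(\<lambda>v. f (x(Suc d := v))) \<in> borel_measurable borel"
      using fm x by (rule measurable_fun_upd_PiM_lborel) simp
    show "(\<integral>\<^sup>+ v. f (x(Suc d := v)) * (\<Prod>k=1..Suc d. indicator {0<..} ((x(Suc d := v)) k)) \<partial>lborel)
       = h x * (\<Prod>k=1..d. indicator {0<..} (x k))"
      unfolding h_def by (subst nn_integral_multc[symmetric]) (auto intro!: nn_integral_cong simp: mult_ac)
  qed
  also have "\<dots> = (\<integral>\<^sup>+z. h (\<lambda>k\<in>{1..d}. ?e z k) * (\<Prod>k=1..d. ennreal (?e z k)) \<partial>?P)"
    by (rule Suc.IH) measurable
  also have "\<dots> = (\<integral>\<^sup>+z. (\<integral>\<^sup>+ w. f (\<lambda>k\<in>{1..Suc d}. ?e (z(Suc d := w)) k) * (\<Prod>k=1..Suc d. ennreal (?e (z(Suc d := w)) k)) \<partial>lborel) \<partial>?P)"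
  proof (rule nn_integral_cong)
    fix z assume z: "z \<in> space ?P"
    let ?x = "\<lambda>k\<in>{1..d}. ?e z k"
    have "?x \<in> space ?P" by (simp add: space_PiM)
    then have fx[measurable]: "(\<lambda>v. f (?x(Suc d := v))) \<in> borel_measurable borel"
      by (intro measurable_fun_upd_PiM_lborel[OF fm]) simp_all
    have eq: "?e (z(Suc d := w)) k = ?e z k" if "k \<le> d" for w k
      using that by (intro arg_cong[where f="\<lambda>s. exp (- s)"] sum.cong) auto
    \<comment> \<open>For d = 0 the empty sum gives the scale \<open>?e z 0 = 1\<close>, so the
      first coordinate is no special case.\<close>
    have eq': "?e (z(Suc d := w)) (Suc d) = ?e z d * exp (- w)" for w
      using eq[of d w] by (simp add: exp_add exp_diff exp_minus divide_inverse)
    have F: "f (\<lambda>k\<in>{1..Suc d}. ?e (z(Suc d := w)) k) = f (?x(Suc d := ?e z d * exp (- w)))" for w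
    proof (intro arg_cong[where f=f] ext)
      show "(\<lambda>k\<in>{1..Suc d}. ?e (z(Suc d := w)) k) k = (?x(Suc d := ?e z d * exp (- w))) k" for k
      proof (cases "k = Suc d")
        case True
        then show ?thesis using eq'[of w] by (simp del: sum.cl_ivl_Suc)
      next
        case False
        then show ?thesis using eq[of k w] by auto
      qed
    qed
    have P: "(\<Prod>k=1..Suc d. ennreal (?e (z(Suc d := w)) k)) = ennreal (?e z d * exp (- w)) * (\<Prod>k=1..d. ennreal (?e z k))" for w
    proof -
      have "(\<Prod>k=1..Suc d. g k) = g (Suc d) * (\<Prod>k=1..d. g k)" for g :: "nat \<Rightarrow> ennreal"
        by (simp add: mult.commute)
      moreover have "(\<Prod>k=1..d. ennreal (?e (z(Suc d := w)) k)) = (\<Prod>k=1..d. ennreal (?e z k))"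
        by (rule prod.cong[OF refl], subst eq) auto
      ultimately show ?thesis
        by (simp only: eq')
    qed
    have fx'[measurable]: "(\<lambda>w. f (?x(Suc d := ?e z d * exp (- w)))) \<in> borel_measurable borel"
      by (rule measurable_compose[OF _ fx]) measurable
    have fm': "(\<lambda>w. f (?x(Suc d := ?e z d * exp (- w))) * ennreal (?e z d * exp (- w))) \<in> borel_measurable lborel"
      unfolding measurable_lborel2 by (intro borel_measurable_times_ennreal fx') measurable
    have "h ?x = (\<integral>\<^sup>+ w. f (?x(Suc d := ?e z d * exp (- w))) * ennreal (?e z d * exp (- w)) \<partial>lborel)"
      unfolding h_def by (rule nn_integral_exp_substitution[OF fx]) simp
    then show "h ?x * (\<Prod>k=1..d. ennreal (?e z k))
      = (\<integral>\<^sup>+ w. f (\<lambda>k\<in>{1..Suc d}. ?e (z(Suc d := w)) k) * (\<Prod>k=1..Suc d. ennreal (?e (z(Suc d := w)) k)) \<partial>lborel)"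
      unfolding F P mult.assoc[symmetric] by (simp only: nn_integral_multc[OF fm'])
  qed
  also have "\<dots> = (\<integral>\<^sup>+z. f (\<lambda>k\<in>{1..Suc d}. ?e z k) * (\<Prod>k=1..Suc d. ennreal (?e z k)) \<partial>Pi\<^sub>M {1..Suc d} (\<lambda>_. lborel))"
    unfolding I by (rule product_nn_integral_insert[symmetric], simp, simp)
      (rule measurable_cumulative_exp_substitution[OF Suc.prems, unfolded I])
  finally show ?case .
qed

section \<open>The simplex in log gap coordinates\<close>

text \<open>This is Y_k / Y_1 as a function of the gaps; the sum starts at 2, so the ratio for k = 1
  is 1. Consequently \<open>ratio_sum\<close> is 1 / Y_1.\<close>

definition rank_ratio :: "(nat \<Rightarrow> real) \<Rightarrow> nat \<Rightarrow> real" where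
  "rank_ratio z k = exp (- (\<Sum>i=2..k. z i))"

definition ratio_sum :: "nat \<Rightarrow> (nat \<Rightarrow> real) \<Rightarrow> real" where
  "ratio_sum d z = (\<Sum>k=1..d. rank_ratio z k)"

definition rank_point :: "nat \<Rightarrow> (nat \<Rightarrow> real) \<Rightarrow> nat \<Rightarrow> real" where
  "rank_point d z = (\<lambda>k\<in>{1..d}. rank_ratio z k / ratio_sum d z)"

lemma rank_ratio_pos: "rank_ratio z k > 0"
  by (simp add: rank_ratio_def)

lemma ratio_sum_pos: "d \<ge> 1 \<Longrightarrow> ratio_sum d z > 0"
  unfolding ratio_sum_def by (rule sum_pos) (auto simp: rank_ratio_pos)

lemma measurable_rank_ratio [measurable]:
  "k \<le> d \<Longrightarrow> (\<lambda>z. rank_ratio z k) \<in> borel_measurable (Pi\<^sub>M {2..d} (\<lambda>_. borel))"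
  unfolding rank_ratio_def
  by (rule measurable_compose[OF _ borel_measurable_exp]) (auto intro!: borel_measurable_uminus borel_measurable_sum)

lemma measurable_ratio_sum [measurable]:
  "ratio_sum d \<in> borel_measurable (Pi\<^sub>M {2..d} (\<lambda>_. borel))"
  unfolding ratio_sum_def[abs_def] by (intro borel_measurable_sum measurable_rank_ratio) auto

lemma measurable_rank_point [measurable]:
  "rank_point d \<in> Pi\<^sub>M {2..d} (\<lambda>_. borel) \<rightarrow>\<^sub>M Pi\<^sub>M {1..d} (\<lambda>_. borel)"
  unfolding rank_point_def[abs_def]
  by (intro measurable_restrict borel_measurable_divide measurable_rank_ratio measurable_ratio_sum) auto

lemma nn_integral_normalise_hyperplane:
  fixes h :: "(nat \<Rightarrow> real) \<Rightarrow> ennreal" and \<phi> :: "real \<Rightarrow> ennreal"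
  assumes d: "d \<ge> 1" and h [measurable]: "h \<in> borel_measurable (Pi\<^sub>M {1..d} (\<lambda>_. borel))"
    and \<phi> [measurable]: "\<phi> \<in> borel_measurable borel" and \<phi>0: "\<And>s. s \<le> 0 \<Longrightarrow> \<phi> s = 0"
  shows "(\<integral>\<^sup>+x. h (\<lambda>k\<in>{1..d}. x k / (\<Sum>i=1..d. x i)) * \<phi> (\<Sum>i=1..d. x i) \<partial>Pi\<^sub>M {1..d} (\<lambda>_. lborel))
    = (\<integral>\<^sup>+s. \<phi> s * ennreal (s ^ (d - 1)) \<partial>lborel) * (\<integral>\<^sup>+y. h y \<partial>hyperplane_lebesgue d)"
proof -
  interpret product_sigma_finite "\<lambda>_::nat. lborel :: real measure" ..
  let ?Q = "Pi\<^sub>M {1..<d} (\<lambda>_. lborel :: real measure)"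
  let ?S = "\<lambda>x :: nat \<Rightarrow> real. \<Sum>i\<in>{1..<d}. x i"
  have I: "{1..d} = insert d {1..<d}" using d by auto
  define G where "G x = h (\<lambda>k\<in>{1..d}. x k / (\<Sum>i=1..d. x i)) * \<phi> (\<Sum>i=1..d. x i)" for x
  have Gm: "G \<in> borel_measurable (Pi\<^sub>M {1..d} (\<lambda>_. lborel))"
    unfolding G_def by measurable
  define P where "P y = (\<lambda>i\<in>{1..d}. if i < d then y i else 1 - ?S y)" for y
  have Pm[measurable]: "P \<in> ?Q \<rightarrow>\<^sub>M Pi\<^sub>M {1..d} (\<lambda>_. borel)"
    unfolding P_def[abs_def]
  proof (rule measurable_restrict)
    show "(\<lambda>y. if i < d then y i else 1 - ?S y) \<in> borel_measurable ?Q" if "i \<in> {1..d}" for i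
      using that by (cases "i < d") (auto intro!: borel_measurable_diff borel_measurable_sum)
  qed
  have h': "h \<in> borel_measurable (distr ?Q (Pi\<^sub>M {1..d} (\<lambda>_. borel)) P)"
    using h by simp
  have "(\<integral>\<^sup>+x. G x \<partial>Pi\<^sub>M {1..d} (\<lambda>_. lborel)) = (\<integral>\<^sup>+x. (\<integral>\<^sup>+v. G (x(d := v)) \<partial>lborel) \<partial>?Q)"
    unfolding I by (rule product_nn_integral_insert) (use Gm I in auto)
  also have "\<dots> = (\<integral>\<^sup>+x. (\<integral>\<^sup>+s. h (P (\<lambda>i\<in>{1..<d}. x i / s)) * \<phi> s \<partial>lborel) \<partial>?Q)"
  proof (rule nn_integral_cong)
    fix x assume x: "x \<in> space ?Q"
    have [measurable]: "(\<lambda>v. G (x(d := v))) \<in> borel_measurable borel"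
      by (rule measurable_fun_upd_PiM_lborel[OF Gm[unfolded I] x]) simp
    have "(\<integral>\<^sup>+v. G (x(d := v)) \<partial>lborel) = (\<integral>\<^sup>+s. G (x(d := - ?S x + s)) \<partial>lborel)"
      using nn_integral_real_affine[of "\<lambda>v. G (x(d := v))" 1 "- ?S x"] by simp
    also have "\<dots> = (\<integral>\<^sup>+s. h (P (\<lambda>i\<in>{1..<d}. x i / s)) * \<phi> s \<partial>lborel)"
    proof (rule nn_integral_cong)
      fix s :: real
      have sum: "(\<Sum>i=1..d. (x(d := - ?S x + s)) i) = s"
        by (simp only: I) (subst sum.insert, auto)
      show "G (x(d := - ?S x + s)) = h (P (\<lambda>i\<in>{1..<d}. x i / s)) * \<phi> s"
      proof (cases "s > 0")
        case True
        \<comment> \<open>In the last entry (s - ?S x) / s is 1 minus the sum of the x_i / s, which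
          is how \<open>P\<close> completes a point to the hyperplane.\<close>
        have "(\<lambda>k\<in>{1..d}. (x(d := - ?S x + s)) k / s) = P (\<lambda>i\<in>{1..<d}. x i / s)"
          using True by (auto simp: P_def fun_eq_iff sum_divide_distrib[symmetric] field_simps)
        then show ?thesis unfolding G_def sum by simp
      qed (unfold G_def sum, simp add: \<phi>0)
    qed
    finally show "(\<integral>\<^sup>+v. G (x(d := v)) \<partial>lborel) = (\<integral>\<^sup>+s. h (P (\<lambda>i\<in>{1..<d}. x i / s)) * \<phi> s \<partial>lborel)" .
  qed
  \<comment> \<open>The total s has to be the outer variable before the rescaling, because the scale
    depends on it.\<close>
  also have "\<dots> = (\<integral>\<^sup>+s. (\<integral>\<^sup>+x. h (P (\<lambda>i\<in>{1..<d}. x i / s)) * \<phi> s \<partial>?Q) \<partial>lborel)"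
  proof (rule pair_sigma_finite.Fubini')
    show "pair_sigma_finite lborel ?Q"
      by (intro pair_sigma_finite.intro lborel.sigma_finite_measure_axioms sigma_finite) auto
  qed measurable
  also have "\<dots> = (\<integral>\<^sup>+s. \<phi> s * ennreal (s ^ (d - 1)) * (\<integral>\<^sup>+y. h (P y) \<partial>?Q) \<partial>lborel)"
  proof (rule nn_integral_cong)
    fix s :: real
    show "(\<integral>\<^sup>+x. h (P (\<lambda>i\<in>{1..<d}. x i / s)) * \<phi> s \<partial>?Q)
      = \<phi> s * ennreal (s ^ (d - 1)) * (\<integral>\<^sup>+y. h (P y) \<partial>?Q)"
    proof (cases "s > 0")
      case True
      have hP: "(\<lambda>x. h (P (\<lambda>i\<in>{1..<d}. x i / s))) \<in> borel_measurable ?Q"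
        by measurable
      have "(\<integral>\<^sup>+x. h (P (\<lambda>i\<in>{1..<d}. x i / s)) * \<phi> s \<partial>?Q)
        = (\<integral>\<^sup>+x. h (P (\<lambda>i\<in>{1..<d}. x i / s)) \<partial>?Q) * \<phi> s"
        by (rule nn_integral_multc) measurable
      also have "(\<integral>\<^sup>+x. h (P (\<lambda>i\<in>{1..<d}. x i / s)) \<partial>?Q)
        = ennreal (s ^ (d - 1)) * (\<integral>\<^sup>+y. h (P (\<lambda>i\<in>{1..<d}. (\<lambda>i\<in>{1..<d}. s * y i) i / s)) \<partial>?Q)"
        by (subst nn_integral_PiM_lborel_scale[OF _ hP True]) simp_all
      also have "(\<lambda>y. P (\<lambda>i\<in>{1..<d}. (\<lambda>i\<in>{1..<d}. s * y i) i / s)) = P"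
        using True by (auto simp: P_def fun_eq_iff intro!: sum.cong)
      then have "(\<integral>\<^sup>+y. h (P (\<lambda>i\<in>{1..<d}. (\<lambda>i\<in>{1..<d}. s * y i) i / s)) \<partial>?Q) = (\<integral>\<^sup>+y. h (P y) \<partial>?Q)"
        by (metis (no_types, lifting))
      finally show ?thesis by (simp only: mult_ac)
    qed (simp add: \<phi>0)
  qed
  also have "\<dots> = (\<integral>\<^sup>+s. \<phi> s * ennreal (s ^ (d - 1)) \<partial>lborel) * (\<integral>\<^sup>+y. h (P y) \<partial>?Q)"
    by (rule nn_integral_multc) measurable
  also have "(\<integral>\<^sup>+y. h (P y) \<partial>?Q) = (\<integral>\<^sup>+y. h y \<partial>hyperplane_lebesgue d)"
    by (simp only: hyperplane_lebesgue_def P_def[abs_def, symmetric] nn_integral_distr[OF Pm h'])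
  finally show ?thesis by (simp add: G_def)
qed

text \<open>The same integral in coordinates z_1, ..., z_d, where z_1 is only the overall scale:
  every x_k carries the factor e^(-z_1). Integrating it out leaves the radial factor times an
  integral over the gaps.\<close>

lemma nn_integral_normalise_rank_point:
  fixes h :: "(nat \<Rightarrow> real) \<Rightarrow> ennreal" and \<phi> :: "real \<Rightarrow> ennreal"
  assumes d: "d \<ge> 1" and h [measurable]: "h \<in> borel_measurable (Pi\<^sub>M {1..d} (\<lambda>_. borel))"
    and pos: "\<And>y k. h y \<noteq> 0 \<Longrightarrow> k \<in> {1..d} \<Longrightarrow> y k > 0"
    and \<phi> [measurable]: "\<phi> \<in> borel_measurable borel" and \<phi>0: "\<And>s. s \<le> 0 \<Longrightarrow> \<phi> s = 0"
  shows "(\<integral>\<^sup>+x. h (\<lambda>k\<in>{1..d}. x k / (\<Sum>i=1..d. x i)) * \<phi> (\<Sum>i=1..d. x i) \<partial>Pi\<^sub>M {1..d} (\<lambda>_. lborel))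
    = (\<integral>\<^sup>+s. \<phi> s * ennreal (s ^ (d - 1)) \<partial>lborel)
      * (\<integral>\<^sup>+z. h (rank_point d z) * (\<Prod>k=1..d. ennreal (rank_point d z k)) \<partial>Pi\<^sub>M {2..d} (\<lambda>_. lborel))"
proof -
  interpret product_sigma_finite "\<lambda>_::nat. lborel :: real measure" ..
  let ?Q = "Pi\<^sub>M {2..d} (\<lambda>_. lborel :: real measure)"
  have I: "{1..d} = insert 1 {2..d}" using d by auto
  define G where "G x = h (\<lambda>k\<in>{1..d}. x k / (\<Sum>i=1..d. x i)) * \<phi> (\<Sum>i=1..d. x i)" for x
  let ?e = "\<lambda>z k. exp (- (\<Sum>i=1..k. z i)) :: real"
  define c where "c = (\<integral>\<^sup>+s. \<phi> s * ennreal (s ^ (d - 1)) \<partial>lborel)"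
  have Gm[measurable]: "G \<in> borel_measurable (Pi\<^sub>M {1..d} (\<lambda>_. lborel))"
    unfolding G_def by measurable
  \<comment> \<open>Log coordinates reach only the positive orthant. By \<open>pos\<close> and
    \<open>\<phi>0\<close> the integrand vanishes elsewhere, so inserting the indicators changes
    nothing.\<close>
  have G0: "G x * (\<Prod>k=1..d. indicator {0<..} (x k)) = G x" for x
  proof (cases "G x = 0")
    case False
    then have "h (\<lambda>k\<in>{1..d}. x k / (\<Sum>i=1..d. x i)) \<noteq> 0" and s: "(\<Sum>i=1..d. x i) > 0"
      using \<phi>0[of "\<Sum>i=1..d. x i"] by (auto simp: G_def not_le[symmetric])
    from pos[OF this(1)] have "\<And>k. k \<in> {1..d} \<Longrightarrow> x k / (\<Sum>i=1..d. x i) > 0" by force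
    with s have "\<And>k. k \<in> {1..d} \<Longrightarrow> x k > 0" by (simp add: zero_less_divide_iff)
    then show ?thesis by simp
  qed simp
  note Km = measurable_cumulative_exp_substitution[OF Gm]
  have "(\<integral>\<^sup>+x. G x \<partial>Pi\<^sub>M {1..d} (\<lambda>_. lborel))
     = (\<integral>\<^sup>+z. G (\<lambda>k\<in>{1..d}. ?e z k) * (\<Prod>k=1..d. ennreal (?e z k)) \<partial>Pi\<^sub>M {1..d} (\<lambda>_. lborel))"
    using nn_integral_cumulative_exp_substitution[OF Gm] by (simp only: G0)
  also have "\<dots> = (\<integral>\<^sup>+z. (\<integral>\<^sup>+w. G (\<lambda>k\<in>{1..d}. ?e (z(1 := w)) k) * (\<Prod>k=1..d. ennreal (?e (z(1 := w)) k)) \<partial>lborel) \<partial>?Q)"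
    unfolding I by (rule product_nn_integral_insert) (use Km I in auto)
  also have "\<dots> = (\<integral>\<^sup>+z. c * (h (rank_point d z) * (\<Prod>k=1..d. ennreal (rank_point d z k))) \<partial>?Q)"
  proof (rule nn_integral_cong)
    fix z
    let ?S = "ratio_sum d z"
    have S: "?S > 0" using d by (rule ratio_sum_pos)
    have e: "?e (z(1 := w)) k = exp (- w) * rank_ratio z k" if "k \<in> {1..d}" for w k
    proof -
      have "{1..k} = insert 1 {2..k}" using that by auto
      then have "(\<Sum>i=1..k. (z(1 := w)) i) = w + (\<Sum>i=2..k. z i)" by simp
      then show ?thesis by (simp add: rank_ratio_def exp_add exp_diff exp_minus field_simps)
    qed
    have sum: "(\<Sum>k=1..d. (\<lambda>k\<in>{1..d}. ?e (z(1 := w)) k) k) = ?S * exp (- w)" for w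
    proof -
      have "(\<Sum>k=1..d. (\<lambda>k\<in>{1..d}. ?e (z(1 := w)) k) k) = (\<Sum>k=1..d. exp (- w) * rank_ratio z k)"
        by (rule sum.cong) (use e in auto)
      then show ?thesis by (simp add: ratio_sum_def sum_distrib_left mult.commute)
    qed
    have point: "(\<lambda>k\<in>{1..d}. (\<lambda>k\<in>{1..d}. ?e (z(1 := w)) k) k / (?S * exp (- w))) = rank_point d z" for w
      unfolding rank_point_def by (rule restrict_ext) (use e in simp)
    \<comment> \<open>The Jacobian is the product of the x_k = s y_k with s = S e^(-w), hence s^d
      times the product of the y_k. One factor s is split off: it is the derivative consumed by the
      substitution from w to s, which leaves s^(d-1).\<close>
    have prod: "(\<Prod>k=1..d. ennreal (?e (z(1 := w)) k))
       = ennreal ((?S * exp (- w)) ^ (d - 1)) * ennreal (?S * exp (- w)) * (\<Prod>k=1..d. ennreal (rank_point d z k))" for w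
    proof -
      have "(\<Prod>k=1..d. ennreal (?e (z(1 := w)) k)) = (\<Prod>k=1..d. ennreal (?S * exp (- w)) * ennreal (rank_point d z k))"
        by (rule prod.cong[OF refl], subst e)
           (use S in \<open>auto simp: rank_point_def ennreal_mult'[symmetric] mult_ac\<close>)
      also have "\<dots> = ennreal (?S * exp (- w)) ^ d * (\<Prod>k=1..d. ennreal (rank_point d z k))"
        by (simp add: prod.distrib)
      also have "ennreal (?S * exp (- w)) ^ d = ennreal ((?S * exp (- w)) ^ (d - 1)) * ennreal (?S * exp (- w))"
        using d S by (cases d) (auto simp: ennreal_power ennreal_mult'[symmetric] mult_ac)
      finally show ?thesis .
    qed
    let ?C = "h (rank_point d z) * (\<Prod>k=1..d. ennreal (rank_point d z k))"
    have "(\<integral>\<^sup>+w. G (\<lambda>k\<in>{1..d}. ?e (z(1 := w)) k) * (\<Prod>k=1..d. ennreal (?e (z(1 := w)) k)) \<partial>lborel)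
      = (\<integral>\<^sup>+w. \<phi> (?S * exp (- w)) * ennreal ((?S * exp (- w)) ^ (d - 1)) * ennreal (?S * exp (- w)) * ?C \<partial>lborel)"
      unfolding G_def sum point prod by (simp only: mult_ac)
    also have "\<dots> = (\<integral>\<^sup>+w. \<phi> (?S * exp (- w)) * ennreal ((?S * exp (- w)) ^ (d - 1)) * ennreal (?S * exp (- w)) \<partial>lborel) * ?C"
      by (rule nn_integral_multc) measurable
    also have "(\<integral>\<^sup>+w. \<phi> (?S * exp (- w)) * ennreal ((?S * exp (- w)) ^ (d - 1)) * ennreal (?S * exp (- w)) \<partial>lborel)
       = (\<integral>\<^sup>+s. (\<phi> s * ennreal (s ^ (d - 1))) * indicator {0<..} s \<partial>lborel)"
      by (rule nn_integral_exp_substitution[symmetric, OF _ S]) measurable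
    also have "\<dots> = c"
      unfolding c_def by (rule nn_integral_cong) (auto simp: \<phi>0 indicator_def)
    finally show "(\<integral>\<^sup>+w. G (\<lambda>k\<in>{1..d}. ?e (z(1 := w)) k) * (\<Prod>k=1..d. ennreal (?e (z(1 := w)) k)) \<partial>lborel) = c * ?C" .
  qed
  also have "\<dots> = c * (\<integral>\<^sup>+z. h (rank_point d z) * (\<Prod>k=1..d. ennreal (rank_point d z k)) \<partial>?Q)"
  proof (rule nn_integral_cmult)
    have "rank_point d \<in> ?Q \<rightarrow>\<^sub>M Pi\<^sub>M {1..d} (\<lambda>_. borel)"
      using measurable_rank_point by (simp cong: measurable_cong_sets sets_PiM_cong)
    then show "(\<lambda>z. h (rank_point d z) * (\<Prod>k=1..d. ennreal (rank_point d z k))) \<in> borel_measurable ?Q"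
      by measurable
  qed
  finally show ?thesis by (simp add: G_def c_def)
qed

text \<open>
  Avoids the Jacobian of the projective map \<open>z \<mapsto> y\<close>: the homogeneous extension \<open>h(x/|x|) \<phi>(|x|)\<close> is
  integrated over \<open>\<real>\<^sup>d\<close> both along rays through the hyperplane and in log coordinates, and the common
  radial factor is cancelled.
\<close>

lemma nn_integral_hyperplane_lebesgue:
  fixes h :: "(nat \<Rightarrow> real) \<Rightarrow> ennreal"
  assumes d: "d \<ge> 1" and h: "h \<in> borel_measurable (Pi\<^sub>M {1..d} (\<lambda>_. borel))"
    and pos: "\<And>y k. h y \<noteq> 0 \<Longrightarrow> k \<in> {1..d} \<Longrightarrow> y k > 0"
  shows "(\<integral>\<^sup>+y. h y \<partial>hyperplane_lebesgue d)
    = (\<integral>\<^sup>+z. h (rank_point d z) * (\<Prod>k=1..d. ennreal (rank_point d z k)) \<partial>Pi\<^sub>M {2..d} (\<lambda>_. lborel))"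
proof -
  \<comment> \<open>On [1, 2] the weight s^(d-1) lies between 1 and 2^(d-1), so the radial factor is
    neither 0 nor infinite and may be cancelled in \<open>ennreal\<close>.\<close>
  let ?\<phi> = "indicator {1..2} :: real \<Rightarrow> ennreal"
  let ?c = "\<integral>\<^sup>+s. ?\<phi> s * ennreal (s ^ (d - 1)) \<partial>lborel"
  have "(\<integral>\<^sup>+s. ?\<phi> s \<partial>lborel) \<le> ?c"
    by (intro nn_integral_mono) (auto simp: indicator_def)
  then have c0: "?c \<noteq> 0" by auto
  have "?c \<le> (\<integral>\<^sup>+s. ennreal (2 ^ (d - 1)) * ?\<phi> s \<partial>lborel)"
    by (intro nn_integral_mono) (auto simp: indicator_def intro!: ennreal_leI power_mono)
  also have "\<dots> < \<infinity>" by (simp add: nn_integral_cmult_indicator ennreal_mult_less_top)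
  finally have "?c \<noteq> \<top>" by auto
  moreover have "?c * (\<integral>\<^sup>+y. h y \<partial>hyperplane_lebesgue d)
    = ?c * (\<integral>\<^sup>+z. h (rank_point d z) * (\<Prod>k=1..d. ennreal (rank_point d z k)) \<partial>Pi\<^sub>M {2..d} (\<lambda>_. lborel))"
    using nn_integral_normalise_hyperplane[OF d h, of ?\<phi>] nn_integral_normalise_rank_point[OF d h _ _, of ?\<phi>] pos
    by simp
  ultimately show ?thesis using c0 by (simp add: ennreal_mult_cancel_left)
qed

section \<open>Multinomial expansion and exponential moments\<close>

lemma multi_indices_0: "multi_indices 0 j = (if j = 0 then {\<lambda>_. undefined} else {})"
  by (auto simp: multi_indices_def tail_sum_def)

text \<open>Induction on the number of variables: the exponent l of the last variable is split off
  by the binomial theorem. Finiteness is carried along, since merging the nested sums into one sum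
  over pairs depends on it.\<close>

lemma sum_power_eq_sum_multi_indices:
  fixes x :: "nat \<Rightarrow> real"
  shows "finite (multi_indices d j) \<and>
    (\<Sum>k=1..d. x k) ^ j = (\<Sum>m\<in>multi_indices d j. multinomial d j m * (\<Prod>k=1..d. x k ^ m k))"
proof (induction d arbitrary: j)
  case 0
  show ?case by (simp add: multi_indices_0 multinomial_def)
next
  case (Suc d)
  have fin: "finite (multi_indices d j)" for j using Suc.IH by simp
  let ?D = "SIGMA l:{..j}. multi_indices d (j - l)"
  let ?up = "\<lambda>p :: nat \<times> (nat \<Rightarrow> nat). (snd p)(Suc d := fst p)"
  have sum_up: "(\<Sum>k=1..d. (m(Suc d := l)) k) = (\<Sum>k=1..d. m k)" for m :: "nat \<Rightarrow> nat" and l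
    by (rule sum.cong) auto
  have bij: "bij_betw ?up ?D (multi_indices (Suc d) j)"
  \<comment> \<open>Restriction resets the entry at \<open>Suc d\<close> to
    \<open>undefined\<close>, as extensionality on \<open>{1..d}\<close> demands.\<close>
  proof (rule bij_betwI[where g="\<lambda>m. (m (Suc d), restrict m {1..d})"])
    show "?up \<in> ?D \<rightarrow> multi_indices (Suc d) j"
    proof
      fix p assume p: "p \<in> ?D"
      then have "?up p \<in> {1..Suc d} \<rightarrow>\<^sub>E UNIV"
        by (auto simp: multi_indices_def PiE_iff extensional_def)
      moreover have "(\<Sum>k=1..Suc d. ?up p k) = j"
        using p sum_up[of "snd p" "fst p"] by (auto simp: multi_indices_def tail_sum_def)
      ultimately show "?up p \<in> multi_indices (Suc d) j"
        by (simp add: multi_indices_def tail_sum_def)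
    qed
    show "(\<lambda>m. (m (Suc d), restrict m {1..d})) \<in> multi_indices (Suc d) j \<rightarrow> ?D"
      by (auto simp: multi_indices_def tail_sum_def)
    show "(\<lambda>m. (m (Suc d), restrict m {1..d})) (?up p) = p" if "p \<in> ?D" for p
      using that by (auto simp: multi_indices_def PiE_iff extensional_def fun_eq_iff restrict_def)
    show "?up ((\<lambda>m. (m (Suc d), restrict m {1..d})) m) = m" if "m \<in> multi_indices (Suc d) j" for m
      using that by (auto simp: multi_indices_def PiE_iff extensional_def fun_eq_iff restrict_def)
  qed
  have "finite ?D" using fin by auto
  then have "finite (multi_indices (Suc d) j)" using bij_betw_finite[OF bij] by simp
  have "(\<Sum>k=1..Suc d. x k) ^ j = (x (Suc d) + (\<Sum>k=1..d. x k)) ^ j" by (simp add: add.commute)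
  also have "\<dots> = (\<Sum>l\<le>j. of_nat (j choose l) * x (Suc d) ^ l * (\<Sum>k=1..d. x k) ^ (j - l))"
    by (rule binomial_ring)
  also have "\<dots> = (\<Sum>l\<le>j. \<Sum>m\<in>multi_indices d (j - l). real (j choose l) * x (Suc d) ^ l
      * (multinomial d (j - l) m * (\<Prod>k=1..d. x k ^ m k)))"
    using Suc.IH by (simp add: sum_distrib_left)
  also have "\<dots> = (\<Sum>(l, m)\<in>?D. real (j choose l) * x (Suc d) ^ l
      * (multinomial d (j - l) m * (\<Prod>k=1..d. x k ^ m k)))"
    by (rule sum.Sigma) (use fin in auto)
  also have "\<dots> = (\<Sum>p\<in>?D. multinomial (Suc d) j (?up p) * (\<Prod>k=1..Suc d. x k ^ ?up p k))"
  proof (rule sum.cong[OF refl])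
    fix p assume "p \<in> ?D"
    then obtain l m where p: "p = (l, m)" and l: "l \<le> j" by auto
    have up: "(\<Prod>k=1..Suc d. f k ((m(Suc d := l)) k)) = f (Suc d) l * (\<Prod>k=1..d. f k (m k))"
      for f :: "nat \<Rightarrow> nat \<Rightarrow> real"
    proof -
      have "(\<Prod>k=1..d. f k ((m(Suc d := l)) k)) = (\<Prod>k=1..d. f k (m k))"
        by (rule prod.cong) auto
      then show ?thesis by (simp add: mult.commute)
    qed
    note P = up[of "\<lambda>k i. x k ^ i"]
    have "(\<Prod>k=1..Suc d. fact ((m(Suc d := l)) k) :: real) = fact l * (\<Prod>k=1..d. fact (m k))"
      by (rule up)
    then have "multinomial (Suc d) j (m(Suc d := l)) = real (j choose l) * multinomial d (j - l) m"
      using l by (simp add: multinomial_def binomial_fact)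
    then show "(case p of (l, m) \<Rightarrow> real (j choose l) * x (Suc d) ^ l * (multinomial d (j - l) m * (\<Prod>k=1..d. x k ^ m k)))
       = multinomial (Suc d) j (?up p) * (\<Prod>k=1..Suc d. x k ^ ?up p k)"
      unfolding p case_prod_conv fst_conv snd_conv P by simp
  qed
  also have "\<dots> = (\<Sum>m\<in>multi_indices (Suc d) j. multinomial (Suc d) j m * (\<Prod>k=1..Suc d. x k ^ m k))"
    by (rule sum.reindex_bij_betw[OF bij])
  finally show ?case using \<open>finite (multi_indices (Suc d) j)\<close> by blast
qed

text \<open>The origin of the tail sums: z_i occurs in every partial sum with k >= i, so exchanging
  the two sums gives it the coefficient v_i + ... + v_d. Through \<open>prod_rank_ratio_powr\<close>
  this is applied to the parameters a and to the multi-indices m alike.\<close>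

lemma sum_mult_partial_sums_eq_tail_sums:
  fixes v z :: "nat \<Rightarrow> real"
  shows "(\<Sum>k=1..d. v k * (\<Sum>i=2..k. z i)) = (\<Sum>i=2..d. tail_sum d v i * z i)"
proof -
  have "(\<Sum>k=1..d. v k * (\<Sum>i=2..k. z i)) = (\<Sum>k\<in>{1..d}. \<Sum>i\<in>{i\<in>{2..d}. i \<le> k}. v k * z i)"
    by (simp add: sum_distrib_left) (intro sum.cong refl, auto)
  also have "\<dots> = (\<Sum>i\<in>{2..d}. \<Sum>k\<in>{k\<in>{1..d}. i \<le> k}. v k * z i)"
    by (rule sum.swap_restrict) auto
  also have "\<dots> = (\<Sum>i=2..d. tail_sum d v i * z i)"
    unfolding tail_sum_def sum_distrib_right by (intro sum.cong refl) auto
  finally show ?thesis .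
qed

text \<open>Exponential tilting: e^(s x) times the density of rate l is l / (l - s) times the
  density of rate l - s, whose n-th moment is n! / (l - s)^n.\<close>

lemma has_bochner_integral_exponential_density:
  assumes l: "0 < l" and s: "s < l"
  shows "has_bochner_integral lborel (\<lambda>x. exponential_density l x * (x ^ n * exp (s * x))) (l * fact n / (l - s) ^ Suc n)"
proof (rule has_bochner_integral_nn_integral)
  have eq: "exponential_density l x * (x ^ n * exp (s * x)) = l / (l - s) * (exponential_density (l - s) x * x ^ n)" for x
  proof -
    have "exp (- x * (l - s)) = exp (- x * l) * exp (s * x)"
      by (simp add: exp_add[symmetric] algebra_simps)
    then show ?thesis using s by (simp add: exponential_density_def)
  qed
  have nn: "0 \<le> exponential_density (l - s) x * x ^ n" for x
    using s by (simp add: erlang_density_def)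
  show "AE x in lborel. 0 \<le> exponential_density l x * (x ^ n * exp (s * x))"
    unfolding eq using l s nn by (intro AE_I2 mult_nonneg_nonneg[OF _ nn]) auto
  have "(\<integral>\<^sup>+x. ennreal (exponential_density l x * (x ^ n * exp (s * x))) \<partial>lborel)
    = ennreal (l / (l - s)) * (\<integral>\<^sup>+x. ennreal (exponential_density (l - s) x * x ^ n) \<partial>lborel)"
  proof -
    have "ennreal (l / (l - s) * u) = ennreal (l / (l - s)) * ennreal u" for u
      using l s by (intro ennreal_mult') simp
    then show ?thesis unfolding eq by (simp only:) (rule nn_integral_cmult, measurable)
  qed
  also have "\<dots> = ennreal (l * fact n / (l - s) ^ Suc n)"
    using l s nn_integral_erlang_ith_moment[of "l - s" 0 n] by (simp add: ennreal_mult'[symmetric])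
  finally show "(\<integral>\<^sup>+x. ennreal (exponential_density l x * (x ^ n * exp (s * x))) \<partial>lborel)
    = ennreal (l * fact n / (l - s) ^ Suc n)" .
qed (use l s in auto)

section \<open>The GRD law as a tilted product of exponentials\<close>

text \<open>Independent exponential gaps with rates abar_2, ..., abar_d, given by a density with
  respect to product Lebesgue measure because that is how the law comes out of the change of
  variables. It does not see abar_1, so a shift of a_1 leaves it unchanged.\<close>

definition exponential_product :: "nat \<Rightarrow> (nat \<Rightarrow> real) \<Rightarrow> (nat \<Rightarrow> real) measure" where
  "exponential_product d a =
     density (Pi\<^sub>M {2..d} (\<lambda>_. lborel)) (\<lambda>z. ennreal (\<Prod>i=2..d. exponential_density (tail_sum d a i) (z i)))"

lemma sets_exponential_product [measurable_cong]:
  "sets (exponential_product d a) = sets (Pi\<^sub>M {2..d} (\<lambda>_. borel))"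
  by (simp add: exponential_product_def cong: sets_PiM_cong)

lemma measurable_prod_exponential_density [measurable]:
  "(\<lambda>z. \<Prod>i=2..d. exponential_density (l i) (z i)) \<in> borel_measurable (Pi\<^sub>M {2..d} (\<lambda>_. lborel))"
  by (intro borel_measurable_prod) auto

text \<open>Independence reduces this to one-dimensional tilted moments. The parameters s and n
  together cover total mass, moment generating function and mixed moments.\<close>

lemma has_bochner_integral_exponential_product:
  assumes "\<And>i. i \<in> {2..d} \<Longrightarrow> 0 < tail_sum d a i" "\<And>i. i \<in> {2..d} \<Longrightarrow> s i < tail_sum d a i"
  shows "has_bochner_integral (exponential_product d a) (\<lambda>z. \<Prod>i=2..d. z i ^ n i * exp (s i * z i))
    (\<Prod>i=2..d. tail_sum d a i * fact (n i) / (tail_sum d a i - s i) ^ Suc (n i))"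
proof -
  interpret product_sigma_finite "\<lambda>_::nat. lborel :: real measure" ..
  let ?g = "\<lambda>i x. exponential_density (tail_sum d a i) x * (x ^ n i * exp (s i * x))"
  have c: "has_bochner_integral lborel (?g i) (tail_sum d a i * fact (n i) / (tail_sum d a i - s i) ^ Suc (n i))"
    if "i \<in> {2..d}" for i
    using that assms by (intro has_bochner_integral_exponential_density) auto
  have "has_bochner_integral (Pi\<^sub>M {2..d} (\<lambda>_. lborel)) (\<lambda>z. \<Prod>i=2..d. ?g i (z i))
    (\<Prod>i=2..d. integral\<^sup>L lborel (?g i))"
    unfolding has_bochner_integral_iff using c
    by (intro conjI product_integral_prod product_integrable_prod) (auto simp: has_bochner_integral_iff)
  also have "(\<Prod>i=2..d. integral\<^sup>L lborel (?g i))
      = (\<Prod>i=2..d. tail_sum d a i * fact (n i) / (tail_sum d a i - s i) ^ Suc (n i))"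
    using c by (intro prod.cong) (auto simp: has_bochner_integral_iff)
  finally have *: "has_bochner_integral (Pi\<^sub>M {2..d} (\<lambda>_. lborel))
     (\<lambda>z. (\<Prod>i=2..d. exponential_density (tail_sum d a i) (z i)) *\<^sub>R (\<Prod>i=2..d. z i ^ n i * exp (s i * z i)))
     (\<Prod>i=2..d. tail_sum d a i * fact (n i) / (tail_sum d a i - s i) ^ Suc (n i))"
    by (simp only: prod.distrib[symmetric] real_scaleR_def)
  show ?thesis
    unfolding exponential_product_def
  proof (rule has_bochner_integral_density[OF _ _ _ *])
    show "(\<lambda>z. \<Prod>i=2..d. z i ^ n i * exp (s i * z i)) \<in> borel_measurable (Pi\<^sub>M {2..d} (\<lambda>_. lborel))"
      by (intro borel_measurable_prod borel_measurable_times borel_measurable_power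
          measurable_compose[OF _ borel_measurable_exp]) auto
    show "AE z in Pi\<^sub>M {2..d} (\<lambda>_. lborel). 0 \<le> (\<Prod>i=2..d. exponential_density (tail_sum d a i) (z i))"
      using assms(1) by (intro AE_I2 prod_nonneg) (simp add: less_imp_le)
  qed measurable
qed

lemma prob_space_exponential_product:
  assumes "\<And>i. i \<in> {2..d} \<Longrightarrow> 0 < tail_sum d a i"
  shows "prob_space (exponential_product d a)"
proof
  have "(\<Prod>i=2..d. tail_sum d a i * fact 0 / (tail_sum d a i - 0) ^ Suc 0) = 1"
    by (rule prod.neutral) (use assms in force)
  then have "has_bochner_integral (exponential_product d a) (\<lambda>z. 1) (1 :: real)"
    using has_bochner_integral_exponential_product[of d a "\<lambda>_. 0" "\<lambda>_. 0"] assms by simp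
  then have int: "integrable (exponential_product d a) (\<lambda>z. 1 :: real)"
    and one: "(\<integral>z. 1 \<partial>exponential_product d a) = (1 :: real)"
    by (simp_all only: has_bochner_integral_iff)
  have "(\<integral>\<^sup>+z. ennreal 1 \<partial>exponential_product d a) = ennreal (\<integral>z. 1 \<partial>exponential_product d a)"
    by (rule nn_integral_eq_integral[OF int]) simp
  then show "emeasure (exponential_product d a) (space (exponential_product d a)) = 1"
    unfolding one by simp
qed

lemma AE_exponential_product_nonneg:
  "AE z in exponential_product d a. \<forall>i\<in>{2..d}. 0 \<le> z i"
proof -
  have "0 \<le> z i" if "0 < ennreal (\<Prod>i=2..d. exponential_density (tail_sum d a i) (z i))" "i \<in> {2..d}" for z i
  proof (rule ccontr)
    assume "\<not> 0 \<le> z i"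
    then have "(\<Prod>i=2..d. exponential_density (tail_sum d a i) (z i)) = 0"
      using that(2) by (intro prod_zero) (auto simp: exponential_density_def not_le)
    with that(1) show False by (simp only: ennreal_0 less_irrefl)
  qed
  moreover have m: "(\<lambda>z. ennreal (\<Prod>i=2..d. exponential_density (tail_sum d a i) (z i)))
      \<in> borel_measurable (Pi\<^sub>M {2..d} (\<lambda>_. lborel))"
    by measurable
  ultimately show ?thesis
    unfolding exponential_product_def AE_density[OF m] by (intro AE_I2) blast
qed

section \<open>Support and density in log gap coordinates\<close>

lemma ratio_sum_bounds:
  assumes "d \<ge> 1" "\<forall>i\<in>{2..d}. 0 \<le> z i"
  shows "1 \<le> ratio_sum d z" "ratio_sum d z \<le> d"
proof -
  have "rank_ratio z k \<le> 1" if "k \<in> {1..d}" for k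
    using that assms by (auto simp: rank_ratio_def intro!: sum_nonneg)
  from sum_mono[of "{1..d}", OF this] show "ratio_sum d z \<le> d" by (simp add: ratio_sum_def)
  have "rank_ratio z 1 \<le> ratio_sum d z"
    unfolding ratio_sum_def by (rule member_le_sum) (use assms rank_ratio_pos in \<open>auto intro: less_imp_le\<close>)
  then show "1 \<le> ratio_sum d z" by (simp add: rank_ratio_def)
qed

lemma prod_rank_ratio_powr:
  "(\<Prod>k=1..d. rank_ratio z k powr v k) = exp (- (\<Sum>i=2..d. tail_sum d v i * z i))"
proof -
  have "(\<Prod>k=1..d. rank_ratio z k powr v k) = (\<Prod>k=1..d. exp (- (v k * (\<Sum>i=2..k. z i))))"
    by (simp add: rank_ratio_def powr_def)
  also have "\<dots> = exp (\<Sum>k=1..d. - (v k * (\<Sum>i=2..k. z i)))"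
    by (rule exp_sum[symmetric]) simp
  also have "\<dots> = exp (- (\<Sum>i=2..d. tail_sum d v i * z i))"
    by (simp only: sum_negf sum_mult_partial_sums_eq_tail_sums)
  finally show ?thesis .
qed

text \<open>The normaliser S is common to neighbouring coordinates and cancels, so the log gaps are
  recovered for every real z, whatever its signs.\<close>

lemma log_gap_rank_point:
  assumes "i \<in> {2..d}"
  shows "log_gap i (rank_point d z) = z i"
proof -
  obtain k where k: "i = Suc k" "k \<ge> 1" using assms by (cases i) auto
  have "{2..Suc k} = insert (Suc k) {2..k}" using k by auto
  moreover have "ratio_sum d z > 0" by (rule ratio_sum_pos) (use assms in auto)
  ultimately show ?thesis
    using assms k by (simp add: log_gap_def rank_point_def ln_div rank_ratio_pos) (simp add: rank_ratio_def)
qed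

text \<open>Neighbouring coordinates differ by the factor e^(-z_i); positivity and total 1 are
  automatic, so only the ordering constrains z.\<close>

lemma rank_point_in_ordered_simplex_iff:
  assumes d: "d \<ge> 1"
  shows "rank_point d z \<in> ordered_simplex d \<longleftrightarrow> (\<forall>i\<in>{2..d}. 0 \<le> z i)"
proof -
  have S: "ratio_sum d z > 0" using d by (rule ratio_sum_pos)
  have step: "rank_point d z (Suc k) \<le> rank_point d z k \<longleftrightarrow> 0 \<le> z (Suc k)" if "k \<in> {1..<d}" for k
  proof -
    have "{2..Suc k} = insert (Suc k) {2..k}" using that by auto
    then have "rank_ratio z (Suc k) \<le> rank_ratio z k \<longleftrightarrow> 0 \<le> z (Suc k)"
      by (simp add: rank_ratio_def)
    then show ?thesis using that S by (simp add: rank_point_def divide_le_cancel)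
  qed
  have "(\<forall>k\<in>{1..<d}. P (Suc k)) \<longleftrightarrow> (\<forall>i\<in>{2..d}. P i)" for P
  proof -
    have "P i" if "\<forall>k\<in>{1..<d}. P (Suc k)" "i \<in> {2..d}" for i
      using that by (cases i) auto
    then show ?thesis by auto
  qed
  moreover have "(\<Sum>k=1..d. rank_point d z k) = 1"
    using S by (simp add: rank_point_def sum_divide_distrib[symmetric] ratio_sum_def)
  moreover have "rank_point d z d \<ge> 0"
    using d S by (simp add: rank_point_def rank_ratio_pos less_imp_le)
  moreover have "rank_point d z \<in> extensional {1..d}" by (simp add: rank_point_def)
  ultimately show ?thesis
    using step by (simp add: ordered_simplex_def)
qed

lemma ordered_simplex_sets: "d \<ge> 1 \<Longrightarrow> ordered_simplex d \<in> sets (Pi\<^sub>M {1..d} (\<lambda>_. borel))"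
proof -
  assume d: "d \<ge> 1"
  let ?N = "Pi\<^sub>M {1..d} (\<lambda>_. borel :: real measure)"
  have [measurable]: "(\<lambda>y. y k) \<in> borel_measurable ?N" if "k \<in> {1..d}" for k
    using that by (rule measurable_component_singleton)
  have "ordered_simplex d = {y \<in> space ?N. (\<forall>k\<in>{1..<d}. y k \<ge> y (Suc k)) \<and> y d \<ge> 0 \<and> (\<Sum>k=1..d. y k) = 1}"
    by (auto simp: ordered_simplex_def space_PiM PiE_def)
  also have "\<dots> \<in> sets ?N"
  proof (intro sets.sets_Collect_conj sets.sets_Collect_finite_All)
    show "{y \<in> space ?N. y k \<ge> y (Suc k)} \<in> sets ?N" if "k \<in> {1..<d}" for k
      using that by (intro borel_measurable_le) auto
    show "{y \<in> space ?N. 0 \<le> y d} \<in> sets ?N" using d by (intro borel_measurable_le) auto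
    show "{y \<in> space ?N. (\<Sum>k=1..d. y k) = 1} \<in> sets ?N" by (intro borel_measurable_eq) auto
  qed auto
  finally show ?thesis .
qed

lemma sets_hyperplane_lebesgue [simp, measurable_cong]:
  "sets (hyperplane_lebesgue d) = sets (Pi\<^sub>M {1..d} (\<lambda>_. borel))"
  by (simp add: hyperplane_lebesgue_def)

lemma GRD_weight_measurable [measurable]:
  "GRD_weight d a \<in> borel_measurable (Pi\<^sub>M {1..d} (\<lambda>_. borel))"
  unfolding GRD_weight_def[abs_def]
  by (intro measurable_compose[OF _ measurable_ennreal] borel_measurable_prod powr_real_measurable) auto

text \<open>The Jacobian raises each exponent a_k - 1 to a_k. Dividing the ratios by S then splits
  the product: the powers of S collect to S^(-abar_1), the ratios to the product of the e^(-abar_i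
  z_i). These are exponential densities without their rates, hence the factors 1 / abar_i. If some
  z_i < 0, both sides vanish, the left one through the simplex and the right one through the
  density.\<close>

lemma GRD_weight_rank_point:
  assumes d: "d \<ge> 1" and a: "\<And>i. i \<in> {2..d} \<Longrightarrow> 0 < tail_sum d a i"
  shows "GRD_weight d a (rank_point d z) * indicator (ordered_simplex d) (rank_point d z) * (\<Prod>k=1..d. ennreal (rank_point d z k))
    = ennreal (\<Prod>i=2..d. exponential_density (tail_sum d a i) (z i))
       * (ennreal (\<Prod>i=2..d. 1 / tail_sum d a i) * ennreal (ratio_sum d z powr (- tail_sum d a 1)))"
proof (cases "\<forall>i\<in>{2..d}. 0 \<le> z i")
  case False
  then have zero: "(\<Prod>i=2..d. exponential_density (tail_sum d a i) (z i)) = 0"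
    by (intro prod_zero) (auto simp: exponential_density_def not_le)
  show ?thesis unfolding zero using False d by (simp add: rank_point_in_ordered_simplex_iff)
next
  case True
  let ?S = "ratio_sum d z"
  have S: "?S > 0" using d by (rule ratio_sum_pos)
  have p: "rank_point d z k > 0" if "k \<in> {1..d}" for k
    using that S rank_ratio_pos by (simp add: rank_point_def)
  have "(\<Prod>k=1..d. rank_point d z k powr (a k - 1)) * (\<Prod>k=1..d. rank_point d z k)
     = (\<Prod>k=1..d. rank_point d z k powr a k)"
    unfolding prod.distrib[symmetric]
    by (rule prod.cong) (use p in \<open>force simp: powr_diff\<close>)+
  also have "\<dots> = (\<Prod>k=1..d. rank_ratio z k powr a k * ?S powr (- a k))"
    by (rule prod.cong) (use S rank_ratio_pos in \<open>auto simp: rank_point_def powr_divide powr_minus_divide less_imp_le\<close>)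
  also have "\<dots> = exp (- (\<Sum>i=2..d. tail_sum d a i * z i)) * ?S powr (- tail_sum d a 1)"
  proof -
    have "(\<Prod>k=1..d. ?S powr (- a k)) = ?S powr (\<Sum>k=1..d. - a k)"
      using S by (intro powr_sum[symmetric]) auto
    also have "(\<Sum>k=1..d. - a k) = - tail_sum d a 1" by (simp add: tail_sum_def sum_negf)
    finally show ?thesis by (simp only: prod.distrib prod_rank_ratio_powr)
  qed
  also have "exp (- (\<Sum>i=2..d. tail_sum d a i * z i))
     = (\<Prod>i=2..d. exponential_density (tail_sum d a i) (z i)) * (\<Prod>i=2..d. 1 / tail_sum d a i)"
  proof -
    have "(\<Prod>i=2..d. exponential_density (tail_sum d a i) (z i)) * (\<Prod>i=2..d. 1 / tail_sum d a i)
       = (\<Prod>i=2..d. exp (- (tail_sum d a i * z i)))"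
      unfolding prod.distrib[symmetric]
      by (rule prod.cong) (use True a in \<open>force simp: exponential_density_def mult.commute\<close>)+
    then show ?thesis by (simp add: exp_sum sum_negf[symmetric])
  qed
  finally have eq: "(\<Prod>k=1..d. rank_point d z k powr (a k - 1)) * (\<Prod>k=1..d. rank_point d z k)
    = (\<Prod>i=2..d. exponential_density (tail_sum d a i) (z i)) * ((\<Prod>i=2..d. 1 / tail_sum d a i) * ?S powr (- tail_sum d a 1))"
    by (simp only: mult.assoc)
  have "(\<Prod>k=1..d. ennreal (rank_point d z k)) = ennreal (\<Prod>k=1..d. rank_point d z k)"
    using p by (intro prod_ennreal) (auto intro: less_imp_le)
  moreover have nonneg: "0 \<le> (\<Prod>i=2..d. exponential_density (tail_sum d a i) (z i))" "0 \<le> (\<Prod>i=2..d. 1 / tail_sum d a i)"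
      "0 \<le> (\<Prod>k=1..d. rank_point d z k powr (a k - 1))"
    using a by (auto intro!: prod_nonneg simp: less_imp_le)
  moreover have "indicator (ordered_simplex d) (rank_point d z) = (1 :: ennreal)"
    using True d by (simp add: rank_point_in_ordered_simplex_iff)
  ultimately have "GRD_weight d a (rank_point d z) * indicator (ordered_simplex d) (rank_point d z) * (\<Prod>k=1..d. ennreal (rank_point d z k))
    = ennreal ((\<Prod>k=1..d. rank_point d z k powr (a k - 1)) * (\<Prod>k=1..d. rank_point d z k))"
    unfolding GRD_weight_def by (simp only: mult_1_right ennreal_mult')
  then show ?thesis
    unfolding eq by (simp only: ennreal_mult' nonneg)
qed

lemma nn_integral_simplex_lebesgue_GRD_weight:
  assumes d: "d \<ge> 1" and a: "\<And>i. i \<in> {2..d} \<Longrightarrow> 0 < tail_sum d a i"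
    and g [measurable]: "g \<in> borel_measurable (Pi\<^sub>M {1..d} (\<lambda>_. borel))"
  shows "(\<integral>\<^sup>+y. GRD_weight d a y * g y \<partial>simplex_lebesgue d)
    = ennreal (\<Prod>i=2..d. 1 / tail_sum d a i)
      * (\<integral>\<^sup>+z. ennreal (ratio_sum d z powr (- tail_sum d a 1)) * g (rank_point d z) \<partial>exponential_product d a)"
proof -
  let ?Q = "Pi\<^sub>M {2..d} (\<lambda>_. lborel :: real measure)"
  have O [measurable]: "ordered_simplex d \<in> sets (Pi\<^sub>M {1..d} (\<lambda>_. borel))" using d by (rule ordered_simplex_sets)
  have "space (hyperplane_lebesgue d) \<in> sets (hyperplane_lebesgue d)" by (rule sets.top)
  then have O': "ordered_simplex d \<inter> space (hyperplane_lebesgue d) \<in> sets (hyperplane_lebesgue d)"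
    using O by (simp only: sets_hyperplane_lebesgue sets.Int)
  have [measurable]: "rank_point d \<in> ?Q \<rightarrow>\<^sub>M Pi\<^sub>M {1..d} (\<lambda>_. borel)" "ratio_sum d \<in> borel_measurable ?Q"
    using measurable_rank_point measurable_ratio_sum by (simp_all cong: measurable_cong_sets sets_PiM_cong)
  have "(\<integral>\<^sup>+y. GRD_weight d a y * g y \<partial>simplex_lebesgue d)
     = (\<integral>\<^sup>+y. GRD_weight d a y * g y * indicator (ordered_simplex d) y \<partial>hyperplane_lebesgue d)"
    unfolding simplex_lebesgue_def
    by (rule nn_integral_restrict_space[OF O'])
  also have "\<dots> = (\<integral>\<^sup>+z. GRD_weight d a (rank_point d z) * g (rank_point d z) * indicator (ordered_simplex d) (rank_point d z)
       * (\<Prod>k=1..d. ennreal (rank_point d z k)) \<partial>?Q)"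
  proof (rule nn_integral_hyperplane_lebesgue[OF d])
    fix y k assume nz: "GRD_weight d a y * g y * indicator (ordered_simplex d) y \<noteq> 0" and k: "k \<in> {1..d}"
    \<comment> \<open>The convention \<open>0 powr x = 0\<close> acts here: the weight is 0 as soon
      as one coordinate is, even for a negative exponent. With y_k >= y_d >= 0 this gives the
      positivity that log coordinates require.\<close>
    have y: "y k \<noteq> 0"
    proof
      assume "y k = 0"
      then have "(\<Prod>k=1..d. y k powr (a k - 1)) = 0" using k by (intro prod_zero) auto
      with nz show False unfolding GRD_weight_def by (simp only: ennreal_0 mult_zero_left)
    qed
    have y': "y \<in> ordered_simplex d" using nz by (auto simp: indicator_def split: if_splits)
    have "k \<le> d" using k by simp
    then have "y k \<ge> y d"
      using k
    proof (induction k rule: inc_induct)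
      case (step n)
      then show ?case using y' by (force simp: ordered_simplex_def)
    qed simp
    moreover have "y d \<ge> 0" using y' by (simp add: ordered_simplex_def)
    ultimately show "y k > 0" using y by auto
  qed measurable
  also have "\<dots> = (\<integral>\<^sup>+z. ennreal (\<Prod>i=2..d. exponential_density (tail_sum d a i) (z i))
       * (ennreal (\<Prod>i=2..d. 1 / tail_sum d a i) * (ennreal (ratio_sum d z powr (- tail_sum d a 1)) * g (rank_point d z))) \<partial>?Q)"
    (is "integral\<^sup>N _ ?l = integral\<^sup>N _ ?r")
  proof (rule nn_integral_cong)
    fix z
    have W: "GRD_weight d a (rank_point d z) * indicator (ordered_simplex d) (rank_point d z)
       * (\<Prod>k=1..d. ennreal (rank_point d z k)) = ennreal (\<Prod>i=2..d. exponential_density (tail_sum d a i) (z i))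
       * (ennreal (\<Prod>i=2..d. 1 / tail_sum d a i) * ennreal (ratio_sum d z powr (- tail_sum d a 1)))"
      using d a by (rule GRD_weight_rank_point)
    have "?l z = (GRD_weight d a (rank_point d z) * indicator (ordered_simplex d) (rank_point d z)
       * (\<Prod>k=1..d. ennreal (rank_point d z k))) * g (rank_point d z)" by (simp only: mult_ac)
    also have "\<dots> = ?r z" unfolding W by (simp only: mult.assoc)
    finally show "?l z = ?r z" .
  qed
  also have "\<dots> = (\<integral>\<^sup>+z. ennreal (\<Prod>i=2..d. 1 / tail_sum d a i)
      * (ennreal (ratio_sum d z powr (- tail_sum d a 1)) * g (rank_point d z)) \<partial>exponential_product d a)"
    unfolding exponential_product_def by (rule nn_integral_density[symmetric]) measurable
  also have "\<dots> = ennreal (\<Prod>i=2..d. 1 / tail_sum d a i)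
      * (\<integral>\<^sup>+z. ennreal (ratio_sum d z powr (- tail_sum d a 1)) * g (rank_point d z) \<partial>exponential_product d a)"
    by (rule nn_integral_cmult) measurable
  finally show ?thesis .
qed

section \<open>Expansion in the binomial series\<close>

lemma ratio_sum_power:
  "ratio_sum d z ^ j = (\<Sum>m\<in>multi_indices d j. multinomial d j m * exp (- (\<Sum>i=2..d. real (tail_sum d m i) * z i)))"
proof -
  have "(\<Prod>k=1..d. rank_ratio z k ^ m k) = exp (- (\<Sum>i=2..d. real (tail_sum d m i) * z i))" for m :: "nat \<Rightarrow> nat"
    using prod_rank_ratio_powr[of z "\<lambda>k. real (m k)" d]
    by (simp add: powr_realpow rank_ratio_pos tail_sum_def)
  then show ?thesis
    unfolding ratio_sum_def using sum_power_eq_sum_multi_indices[where x="rank_ratio z" and d=d and j=j] by simp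
qed

section \<open>Normalising constant and transfer of expectations\<close>

lemma powr_between:
  fixes x :: real
  assumes "1 \<le> x" "x \<le> b"
  shows "min 1 (b powr r) \<le> x powr r" "x powr r \<le> max 1 (b powr r)"
proof -
  have "1 \<le> x powr r \<and> x powr r \<le> b powr r" if "r \<ge> 0"
    using that assms powr_mono2[of r x b] by (auto simp: ge_one_powr_ge_zero)
  moreover have "b powr r \<le> x powr r \<and> x powr r \<le> 1" if "r \<le> 0"
    using that assms powr_mono2'[of r x b] powr_mono2'[of r 1 x] by auto
  ultimately show "min 1 (b powr r) \<le> x powr r" "x powr r \<le> max 1 (b powr r)"
    by (cases "r \<ge> 0"; force)+
qed

text \<open>The mean of S^r under independent exponential gaps. It normalises the tilted density,
  and \<open>mixture_const_eq\<close> identifies it with the constant C.\<close>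

definition exponential_normaliser :: "nat \<Rightarrow> (nat \<Rightarrow> real) \<Rightarrow> real \<Rightarrow> real" where
  "exponential_normaliser d a r = (\<integral>z. ratio_sum d z powr r \<partial>exponential_product d a)"

lemma exponential_normaliser:
  assumes d: "d \<ge> 1" and a: "\<And>i. i \<in> {2..d} \<Longrightarrow> 0 < tail_sum d a i"
  shows "integrable (exponential_product d a) (\<lambda>z. ratio_sum d z powr r)"
    and "exponential_normaliser d a r > 0"
proof -
  interpret prob_space "exponential_product d a" using a by (rule prob_space_exponential_product)
  \<comment> \<open>The sign of r decides whether x^r increases or decreases in x, so bounds valid
    for either sign are the minimum and maximum of the end values 1 and d^r. The upper one gives
    integrability, the positive lower one keeps the mean away from 0.\<close>
  have bounds: "AE z in exponential_product d a. min 1 (real d powr r) \<le> ratio_sum d z powr r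
      \<and> ratio_sum d z powr r \<le> max 1 (real d powr r)"
    using AE_exponential_product_nonneg
    by eventually_elim (intro conjI powr_between ratio_sum_bounds[OF d])
  show int: "integrable (exponential_product d a) (\<lambda>z. ratio_sum d z powr r)"
    by (rule integrable_const_bound[where B="max 1 (real d powr r)"]) (use bounds in auto)
  have "min 1 (real d powr r) \<le> exponential_normaliser d a r"
    unfolding exponential_normaliser_def by (rule integral_ge_const[OF int]) (use bounds in auto)
  moreover have "0 < min 1 (real d powr r)" using d by simp
  ultimately show "exponential_normaliser d a r > 0" by linarith
qed

lemma measurable_GRD: "f \<in> Pi\<^sub>M {1..d} (\<lambda>_. borel) \<rightarrow>\<^sub>M M \<Longrightarrow> f \<in> GRD d a \<rightarrow>\<^sub>M M"
  by (simp add: GRD_def simplex_lebesgue_def measurable_restrict_space1 cong: measurable_cong_sets)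

lemma measurable_rank_point_density:
  "rank_point d \<in> density (exponential_product d a) f \<rightarrow>\<^sub>M Pi\<^sub>M {1..d} (\<lambda>_. borel)"
proof -
  have "measurable (density (exponential_product d a) f) (Pi\<^sub>M {1..d} (\<lambda>_. borel :: real measure))
    = measurable (Pi\<^sub>M {2..d} (\<lambda>_. borel)) (Pi\<^sub>M {1..d} (\<lambda>_. borel))"
    by (rule measurable_cong_sets) (simp_all add: sets_exponential_product)
  then show ?thesis using measurable_rank_point by simp
qed

text \<open>\<open>GRD\<close> lives on a space restricted to the ordered simplex. Pushing it
  forward along the identity places it on the full product sigma-algebra, where it can be compared
  with the image of the tilted law. The product of the 1 / abar_i occurs both in the integral and in
  \<open>GRD_const\<close> and cancels.\<close>

lemma distr_GRD:
  assumes d: "d \<ge> 1" and a: "\<And>i. i \<in> {2..d} \<Longrightarrow> 0 < tail_sum d a i"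
    and r: "r = - tail_sum d a 1"
  shows "distr (GRD d a) (Pi\<^sub>M {1..d} (\<lambda>_. borel)) (\<lambda>y. y)
    = distr (density (exponential_product d a) (\<lambda>z. ennreal (ratio_sum d z powr r / exponential_normaliser d a r)))
        (Pi\<^sub>M {1..d} (\<lambda>_. borel)) (rank_point d)"
    (is "distr _ ?N _ = distr (density ?M _) _ _")
proof (rule measure_eqI)
  let ?C = "exponential_normaliser d a r"
  let ?K = "\<Prod>i=2..d. 1 / tail_sum d a i"
  have C: "?C > 0" and int: "integrable ?M (\<lambda>z. ratio_sum d z powr r)"
    using exponential_normaliser[OF d a] by auto
  have K: "?K > 0" using a by (intro prod_pos) auto
  fix A assume "A \<in> sets (distr (GRD d a) ?N (\<lambda>y. y))"
  then have A [measurable]: "A \<in> sets ?N" by simp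
  have indN: "indicator A \<in> borel_measurable ?N" using A by (rule borel_measurable_indicator)
  let ?X = "\<integral>\<^sup>+z. ennreal (ratio_sum d z powr r) * indicator A (rank_point d z) \<partial>?M"
  have weight [measurable]: "GRD_weight d a \<in> borel_measurable (simplex_lebesgue d)"
    and ind [measurable]: "indicator A \<in> borel_measurable (simplex_lebesgue d)"
    unfolding simplex_lebesgue_def by (intro measurable_restrict_space1; measurable)+
  \<comment> \<open>The integrand 1 shows that \<open>GRD_const\<close> is positive and finite, so
    the division by it behaves as over the reals.\<close>
  have "GRD_const d a = ennreal ?K * (\<integral>\<^sup>+z. ennreal (ratio_sum d z powr r) * 1 \<partial>?M)"
    unfolding GRD_const_def r using nn_integral_simplex_lebesgue_GRD_weight[OF d a, of "\<lambda>_. 1"] by simp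
  also have "(\<integral>\<^sup>+z. ennreal (ratio_sum d z powr r) * 1 \<partial>?M) = ennreal ?C"
    unfolding exponential_normaliser_def using nn_integral_eq_integral[OF int] by simp
  finally have const: "GRD_const d a = ennreal (?K * ?C)" using K by (simp add: ennreal_mult')
  have "emeasure (distr (GRD d a) ?N (\<lambda>y. y)) A = (\<integral>\<^sup>+y. indicator A y \<partial>distr (GRD d a) ?N (\<lambda>y. y))"
    using A by simp
  also have "\<dots> = (\<integral>\<^sup>+y. indicator A y \<partial>GRD d a)"
    by (rule nn_integral_distr, rule measurable_GRD, simp) (simp only: measurable_distr_eq1 indN)
  also have "\<dots> = (\<integral>\<^sup>+y. GRD_weight d a y / GRD_const d a * indicator A y \<partial>simplex_lebesgue d)"
    unfolding GRD_def by (rule nn_integral_density) measurable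
  also have "\<dots> = (\<integral>\<^sup>+y. GRD_weight d a y * indicator A y / GRD_const d a \<partial>simplex_lebesgue d)"
    by (simp only: divide_ennreal_def mult_ac)
  also have "\<dots> = (\<integral>\<^sup>+y. GRD_weight d a y * indicator A y \<partial>simplex_lebesgue d) / GRD_const d a"
    by (rule nn_integral_divide) measurable
  also have "\<dots> = (ennreal ?K * ?X) / ennreal (?K * ?C)"
    unfolding const r by (simp only: nn_integral_simplex_lebesgue_GRD_weight[OF d a indN])
  also have "\<dots> = ?X * (ennreal ?K * ennreal (inverse (?K * ?C)))"
    using K C by (subst divide_ennreal_def) (simp add: inverse_ennreal mult_ac)
  also have "ennreal ?K * ennreal (inverse (?K * ?C)) = ennreal (inverse ?C)"
  proof -
    have "k * inverse (k * c) = inverse c" if "k > 0" for k c :: real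
      using that by simp
    from this[OF K] show ?thesis
      using K by (simp only: ennreal_mult'[symmetric] less_imp_le)
  qed
  also have "?X * ennreal (inverse ?C) = (\<integral>\<^sup>+z. ennreal (ratio_sum d z powr r) * indicator A (rank_point d z) * ennreal (inverse ?C) \<partial>?M)"
    by (rule nn_integral_multc[symmetric]) measurable
  also have "\<dots> = (\<integral>\<^sup>+z. ennreal (ratio_sum d z powr r / ?C) * indicator A (rank_point d z) \<partial>?M)"
  proof (rule nn_integral_cong)
    fix z
    have "ennreal (ratio_sum d z powr r / ?C) = ennreal (ratio_sum d z powr r) * ennreal (inverse ?C)"
      by (simp add: divide_inverse ennreal_mult')
    then show "ennreal (ratio_sum d z powr r) * indicator A (rank_point d z) * ennreal (inverse ?C)
       = ennreal (ratio_sum d z powr r / ?C) * indicator A (rank_point d z)" by (simp only: mult_ac)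
  qed
  also have "\<dots> = (\<integral>\<^sup>+z. indicator A (rank_point d z) \<partial>density ?M (\<lambda>z. ennreal (ratio_sum d z powr r / ?C)))"
    by (rule nn_integral_density[symmetric]) measurable
  also have "\<dots> = emeasure (distr (density ?M (\<lambda>z. ennreal (ratio_sum d z powr r / ?C))) ?N (rank_point d)) A"
    using A indN by (simp add: nn_integral_distr[OF measurable_rank_point_density, symmetric] del: nn_integral_indicator)
      (simp add: nn_integral_indicator)
  finally show "emeasure (distr (GRD d a) ?N (\<lambda>y. y)) A
    = emeasure (distr (density ?M (\<lambda>z. ennreal (ratio_sum d z powr r / ?C))) ?N (rank_point d)) A" .
qed simp

lemma
  assumes d: "d \<ge> 1" and a: "\<And>i. i \<in> {2..d} \<Longrightarrow> 0 < tail_sum d a i"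
    and r: "r = - tail_sum d a 1" and f [measurable]: "f \<in> borel_measurable (Pi\<^sub>M {1..d} (\<lambda>_. borel))"
  shows integrable_GRD_iff: "integrable (GRD d a) f \<longleftrightarrow>
      integrable (exponential_product d a) (\<lambda>z. ratio_sum d z powr r * f (rank_point d z))" (is ?int)
    and integral_GRD: "(\<integral>y. f y \<partial>GRD d a) =
      (\<integral>z. ratio_sum d z powr r * f (rank_point d z) \<partial>exponential_product d a) / exponential_normaliser d a r"
        (is ?eq)
proof -
  let ?M = "exponential_product d a" and ?N = "Pi\<^sub>M {1..d} (\<lambda>_. borel :: real measure)"
  let ?C = "exponential_normaliser d a r"
  let ?L = "density ?M (\<lambda>z. ennreal (ratio_sum d z powr r / ?C))"
  have C: "?C > 0" using exponential_normaliser[OF d a] by auto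
  note distr = distr_GRD[OF d a r]
  have id: "(\<lambda>y. y) \<in> GRD d a \<rightarrow>\<^sub>M ?N" by (rule measurable_GRD) simp
  note T = measurable_rank_point_density
  have "integrable (GRD d a) f \<longleftrightarrow> integrable ?L (\<lambda>z. f (rank_point d z))"
    using integrable_distr_eq[OF id f] integrable_distr_eq[OF T f] distr by simp
  also have "\<dots> \<longleftrightarrow> integrable ?M (\<lambda>z. (ratio_sum d z powr r / ?C) *\<^sub>R f (rank_point d z))"
    by (rule integrable_density) (use C in auto)
  also have "(\<lambda>z. (ratio_sum d z powr r / ?C) *\<^sub>R f (rank_point d z)) = (\<lambda>z. ratio_sum d z powr r * f (rank_point d z) / ?C)"
    by simp
  also have "integrable ?M (\<lambda>z. ratio_sum d z powr r * f (rank_point d z) / ?C)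
      \<longleftrightarrow> integrable ?M (\<lambda>z. ratio_sum d z powr r * f (rank_point d z))" (is "integrable _ ?u \<longleftrightarrow> integrable _ ?v")
  proof
    assume "integrable ?M ?u"
    then have "integrable ?M (\<lambda>z. ?C * ?u z)" by (rule integrable_mult_right)
    then show "integrable ?M ?v" using C by simp
  qed simp
  finally show ?int .
  have "(\<integral>y. f y \<partial>GRD d a) = (\<integral>z. f (rank_point d z) \<partial>?L)"
    using integral_distr[OF id f] integral_distr[OF T f] distr by simp
  also have "\<dots> = (\<integral>z. (ratio_sum d z powr r / ?C) *\<^sub>R f (rank_point d z) \<partial>?M)"
    by (rule integral_density) (use C in auto)
  also have "\<dots> = (\<integral>z. ratio_sum d z powr r * f (rank_point d z) / ?C \<partial>?M)" by simp
  also have "\<dots> = (\<integral>z. ratio_sum d z powr r * f (rank_point d z) \<partial>?M) / ?C" by (rule integral_divide_zero)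
  finally show ?eq .
qed

text \<open>Almost surely the k-th term of the series for S^r g is at most |c_k| (d - 1)^k |g|, with
  a summable numerical factor, so summation and integration commute for every integrable g.
  Multiplying by S^r thus costs no integrability.\<close>

lemma sums_integral_ratio_sum_powr:
  fixes g :: "(nat \<Rightarrow> real) \<Rightarrow> real"
  assumes d: "d \<ge> 1" and g: "integrable (exponential_product d a) g"
  shows "integrable (exponential_product d a) (\<lambda>z. ratio_sum d z powr r * g z)" (is ?int)
    and "(\<lambda>k. (r gchoose k) * (\<Sum>j=0..k. real (k choose j) * (-1) ^ (k - j) * real d powr (r - real j)
         * (\<Sum>m\<in>multi_indices d j. multinomial d j m
             * (\<integral>z. g z * exp (- (\<Sum>i=2..d. real (tail_sum d m i) * z i)) \<partial>exponential_product d a))))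
       sums (\<integral>z. ratio_sum d z powr r * g z \<partial>exponential_product d a)" (is ?sums)
proof -
  let ?M = "exponential_product d a"
  have [measurable]: "g \<in> borel_measurable ?M" using g by simp
  define c where "c k = (r gchoose k) * real d powr (r - real k)" for k
  define f where "f k z = c k * (ratio_sum d z - real d) ^ k * g z" for k z
  define b where "b k = norm (c k * (real d - 1) ^ k)" for k
  have fm [measurable]: "f k \<in> borel_measurable ?M" for k unfolding f_def[abs_def] by measurable
  \<comment> \<open>\<open>powser_insidea\<close> turns convergence at one point into absolute
    convergence at points of smaller modulus; d - 1/2 lies strictly between d - 1, where the bound
    is wanted, and the radius d.\<close>
  have "(\<lambda>k. c k * (real d - 1/2) ^ k) sums (real d + (real d - 1/2)) powr r"
    unfolding c_def by (rule gen_binomial_real'') (use d in auto)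
  then have b_summable: "summable b"
    unfolding b_def by (intro powser_insidea[where x="real d - 1/2"] sums_summable) (use d in auto)
  have f_sums: "(\<lambda>k. f k z) sums (ratio_sum d z powr r * g z)" and f_le: "norm (f k z) \<le> b k * norm (g z)"
    if z: "\<forall>i\<in>{2..d}. 0 \<le> z i" for z k
  proof -
    note S = ratio_sum_bounds[OF d z]
    have "(\<lambda>k. c k * (ratio_sum d z - real d) ^ k) sums (real d + (ratio_sum d z - real d)) powr r"
      unfolding c_def by (rule gen_binomial_real'') (use S d in auto)
    from sums_mult2[OF this, of "g z"] show "(\<lambda>k. f k z) sums (ratio_sum d z powr r * g z)"
      by (simp add: f_def)
    have "\<bar>ratio_sum d z - real d\<bar> ^ k \<le> (real d - 1) ^ k"
      by (rule power_mono) (use S in auto)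
    then show "norm (f k z) \<le> b k * norm (g z)"
      unfolding f_def b_def real_norm_def abs_mult power_abs
      using d by (intro mult_right_mono mult_left_mono) auto
  qed
  have f_int: "integrable ?M (f k)" for k
  proof (rule Bochner_Integration.integrable_bound[OF _ fm])
    show "integrable ?M (\<lambda>z. b k * g z)" using g by simp
    show "AE z in ?M. norm (f k z) \<le> norm (b k * g z)"
      using AE_exponential_product_nonneg by eventually_elim (use f_le in \<open>simp add: b_def abs_mult\<close>)
  qed
  have summable_norm: "AE z in ?M. summable (\<lambda>k. norm (f k z))"
    using AE_exponential_product_nonneg
  proof eventually_elim
    case (elim z)
    show ?case
      by (rule summable_comparison_test'[OF summable_mult2[OF b_summable, of "norm (g z)"]]) (use f_le[OF elim] in simp)
  qed
  have summable_int: "summable (\<lambda>k. \<integral>z. norm (f k z) \<partial>?M)"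
  proof (rule summable_comparison_test'[OF summable_mult2[OF b_summable, of "\<integral>z. norm (g z) \<partial>?M"]])
    fix k
    have "(\<integral>z. norm (f k z) \<partial>?M) \<le> (\<integral>z. b k * norm (g z) \<partial>?M)"
    proof (rule integral_mono_AE)
      show "AE z in ?M. norm (f k z) \<le> b k * norm (g z)"
        using AE_exponential_product_nonneg by eventually_elim (rule f_le)
    qed (use f_int g in auto)
    then show "norm (\<integral>z. norm (f k z) \<partial>?M) \<le> b k * (\<integral>z. norm (g z) \<partial>?M)" by simp
  qed
  have AE_eq: "AE z in ?M. (\<Sum>k. f k z) = ratio_sum d z powr r * g z"
    using AE_exponential_product_nonneg by eventually_elim (rule sums_unique[symmetric, OF f_sums])
  have sum_int: "integrable ?M (\<lambda>z. \<Sum>k. f k z)"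
    by (rule integrable_suminf[OF f_int summable_norm summable_int])
  show ?int
    by (rule integrable_cong_AE_imp[OF sum_int _ AE_eq]) measurable
  have "(\<lambda>k. integral\<^sup>L ?M (f k)) sums (\<integral>z. (\<Sum>k. f k z) \<partial>?M)"
    by (rule sums_integral[OF f_int summable_norm summable_int])
  also have "(\<integral>z. (\<Sum>k. f k z) \<partial>?M) = (\<integral>z. ratio_sum d z powr r * g z \<partial>?M)"
    by (rule integral_cong_AE[OF _ _ AE_eq]) measurable
  finally have base: "(\<lambda>k. integral\<^sup>L ?M (f k)) sums (\<integral>z. ratio_sum d z powr r * g z \<partial>?M)" .
  have "integral\<^sup>L ?M (f k) = (r gchoose k) * (\<Sum>j=0..k. real (k choose j) * (-1) ^ (k - j) * real d powr (r - real j)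
         * (\<Sum>m\<in>multi_indices d j. multinomial d j m
             * (\<integral>z. g z * exp (- (\<Sum>i=2..d. real (tail_sum d m i) * z i)) \<partial>?M)))" for k
  proof -
    let ?e = "\<lambda>m z. exp (- (\<Sum>i=2..d. real (tail_sum d m i) * z i)) :: real"
    have ge: "integrable ?M (\<lambda>z. g z * ?e m z)" for m
    proof (rule Bochner_Integration.integrable_bound[OF g])
      have "(\<lambda>z. ?e m z) \<in> borel_measurable ?M"
        by (rule measurable_compose[OF _ borel_measurable_exp]) (auto intro!: borel_measurable_uminus borel_measurable_sum cong: measurable_cong_sets[OF sets_exponential_product refl])
      then show "(\<lambda>z. g z * ?e m z) \<in> borel_measurable ?M" by measurable
      show "AE z in ?M. norm (g z * ?e m z) \<le> norm (g z)"
        using AE_exponential_product_nonneg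
        by eventually_elim (auto simp: abs_mult intro!: mult_left_le sum_nonneg)
    qed
    have "f k z = (r gchoose k) * (\<Sum>j=0..k. real (k choose j) * (-1) ^ (k - j) * real d powr (r - real j)
         * (\<Sum>m\<in>multi_indices d j. multinomial d j m * (g z * ?e m z)))" for z
    proof -
      \<comment> \<open>Expanding (S - d)^k brings in (-d)^(k-j), and d^(r-k) d^(k-j) = d^(r-j):
        this is where the signs and the powers of d in the weights come from.\<close>
      have "real d powr (r - real k) * (ratio_sum d z - real d) ^ k
        = real d powr (r - real k) * (\<Sum>j=0..k. real (k choose j) * ratio_sum d z ^ j * (- real d) ^ (k - j))"
        using binomial_ring[of "ratio_sum d z" "- real d" k] by (simp add: atLeast0AtMost)
      also have "\<dots> = (\<Sum>j=0..k. real (k choose j) * (-1) ^ (k - j) * real d powr (r - real j) * ratio_sum d z ^ j)"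
        unfolding sum_distrib_left
      proof (rule sum.cong[OF refl])
        fix j assume "j \<in> {0..k}"
        then have "real d powr (r - real j) = real d powr (r - real k) * real d ^ (k - j)"
          using d by (simp add: powr_realpow[symmetric] powr_add[symmetric] of_nat_diff)
        then show "real d powr (r - real k) * (real (k choose j) * ratio_sum d z ^ j * (- real d) ^ (k - j))
          = real (k choose j) * (-1) ^ (k - j) * real d powr (r - real j) * ratio_sum d z ^ j"
          by (subst power_minus) (simp only: mult_ac)
      qed
      finally have "f k z = (r gchoose k) * (\<Sum>j=0..k. real (k choose j) * (-1) ^ (k - j) * real d powr (r - real j)
         * (ratio_sum d z ^ j * g z))"
        by (simp add: f_def c_def mult.assoc sum_distrib_right)
      moreover have "ratio_sum d z ^ j * g z = (\<Sum>m\<in>multi_indices d j. multinomial d j m * (g z * ?e m z))" for j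
        unfolding ratio_sum_power sum_distrib_right by (simp only: mult_ac)
      ultimately show ?thesis by (simp only:)
    qed
    then have fk: "f k = (\<lambda>z. (r gchoose k) * (\<Sum>j=0..k. real (k choose j) * (-1) ^ (k - j) * real d powr (r - real j)
         * (\<Sum>m\<in>multi_indices d j. multinomial d j m * (g z * ?e m z))))"
      by (rule ext)
    have "has_bochner_integral ?M (f k) ((r gchoose k) * (\<Sum>j=0..k. real (k choose j) * (-1) ^ (k - j) * real d powr (r - real j)
         * (\<Sum>m\<in>multi_indices d j. multinomial d j m * (\<integral>z. g z * ?e m z \<partial>?M))))"
      unfolding fk
      by (intro has_bochner_integral_mult_right has_bochner_integral_sum has_bochner_integral_integrable ge)
    then show ?thesis by (rule has_bochner_integral_integral_eq)
  qed
  with base show ?sums by (simp only:)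
qed

section \<open>The constant C and the final expansions\<close>

lemma tail_sum_fun_upd_first: "i \<ge> 2 \<Longrightarrow> tail_sum d (a(1 := x)) i = tail_sum d a i"
  unfolding tail_sum_def by (rule sum.cong) auto

lemma tail_sum_fun_upd_first_1:
  fixes a :: "nat \<Rightarrow> real"
  assumes "d \<ge> 1"
  shows "tail_sum d (a(1 := a 1 + x)) 1 = tail_sum d a 1 + x"
proof -
  have "{1..d} = insert 1 {2..d}" using assms by auto
  moreover have "(\<Sum>i=2..d. (a(1 := a 1 + x)) i) = (\<Sum>i=2..d. a i)" by (rule sum.cong) auto
  ultimately show ?thesis by (simp add: tail_sum_def)
qed

text \<open>The parameter a + r e_1 has total 0, so the gaps under its law are exactly the
  independent exponentials, with the same rates as for a. Since Y_1 = 1 / S, the expectation of 1 /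
  Y_1^r is the mean of S^r.\<close>

lemma
  assumes d: "d \<ge> 1" and a: "\<And>i. i \<in> {2..d} \<Longrightarrow> 0 < tail_sum d a i"
    and r: "r = - tail_sum d a 1"
  shows integrable_GRD_first_powr: "integrable (GRD d (a(1 := a 1 + r))) (\<lambda>y. 1 / y 1 powr r)"
    and mixture_const_eq: "mixture_const d a r = exponential_normaliser d a r"
proof -
  let ?a = "a(1 := a 1 + r)"
  have tail: "tail_sum d ?a i = tail_sum d a i" if "i \<in> {2..d}" for i
    using that by (intro tail_sum_fun_upd_first) auto
  have M: "exponential_product d ?a = exponential_product d a"
    unfolding exponential_product_def
    by (intro arg_cong2[where f=density] refl ext arg_cong[where f=ennreal] prod.cong) (simp only: tail)
  have a': "0 < tail_sum d ?a i" if "i \<in> {2..d}" for i using a tail that by simp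
  have r': "0 = - tail_sum d ?a 1" using d r by (simp only: tail_sum_fun_upd_first_1)
  \<comment> \<open>Strict positivity matters because \<open>0 powr 0\<close> is 0, not 1.\<close>
  have S: "ratio_sum d z > 0" for z using d by (rule ratio_sum_pos)
  interpret prob_space "exponential_product d a" using a by (rule prob_space_exponential_product)
  have C: "exponential_normaliser d ?a 0 = 1"
    unfolding exponential_normaliser_def M using S by (simp add: less_imp_neq[symmetric] prob_space)
  have f: "(\<lambda>y. 1 / y 1 powr r) \<in> borel_measurable (Pi\<^sub>M {1..d} (\<lambda>_. borel))"
    using d by (intro borel_measurable_divide powr_real_measurable) auto
  have eq: "ratio_sum d z powr 0 * (1 / rank_point d z 1 powr r) = ratio_sum d z powr r" for z
    using S[of z] d by (simp add: rank_point_def rank_ratio_def powr_divide)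
  show "integrable (GRD d ?a) (\<lambda>y. 1 / y 1 powr r)"
  proof -
    have "integrable (GRD d ?a) (\<lambda>y. 1 / y 1 powr r)
      \<longleftrightarrow> integrable (exponential_product d ?a) (\<lambda>z. ratio_sum d z powr 0 * (1 / rank_point d z 1 powr r))"
      using d a' r' f by (rule integrable_GRD_iff)
    also have "\<dots>" unfolding M eq using d a by (rule exponential_normaliser)
    finally show ?thesis .
  qed
  show "mixture_const d a r = exponential_normaliser d a r"
  proof -
    have "mixture_const d a r = (\<integral>z. ratio_sum d z powr 0 * (1 / rank_point d z 1 powr r) \<partial>exponential_product d ?a)
        / exponential_normaliser d ?a 0"
      unfolding mixture_const_def using d a' r' f by (rule integral_GRD)
    then show ?thesis unfolding M eq C by (simp add: exponential_normaliser_def)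
  qed
qed

text \<open>One computation for all three series: n = t = 0 yields the constant C, n = 0 the moment
  generating function, t = 0 the mixed moments. The integrand is described by its values on
  \<open>rank_point\<close>, which determine its expectation. The second conclusion is left
  unnormalised so that it can evaluate C itself.\<close>

lemma GRD_log_gap_expectation:
  fixes f :: "(nat \<Rightarrow> real) \<Rightarrow> real" and n :: "nat \<Rightarrow> nat"
  assumes d: "d \<ge> 1" and a: "\<And>i. i \<in> {2..d} \<Longrightarrow> 0 < tail_sum d a i"
    and r: "r = - tail_sum d a 1" and t: "\<And>i. i \<in> {2..d} \<Longrightarrow> t i < tail_sum d a i"
    and f: "f \<in> borel_measurable (Pi\<^sub>M {1..d} (\<lambda>_. borel))"
    and f_eq: "\<And>z. f (rank_point d z) = (\<Prod>i=2..d. z i ^ n i * exp (t i * z i))"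
  shows "integrable (GRD d a) f"
    and "(\<lambda>k. (r gchoose k) * (\<Sum>j=0..k. real (k choose j) * (-1) ^ (k - j) * real d powr (r - real j)
         * (\<Sum>m\<in>multi_indices d j. multinomial d j m
             * (\<Prod>i=2..d. tail_sum d a i * fact (n i) / (tail_sum d a i - t i + real (tail_sum d m i)) ^ Suc (n i)))))
       sums (mixture_const d a r * (\<integral>y. f y \<partial>GRD d a))"
    and "(\<lambda>k. \<Sum>j=0..k. \<Sum>m\<in>multi_indices d j. mixture_weight d a r j k m
           * (\<Prod>i=2..d. (tail_sum d a i + real (tail_sum d m i)) * fact (n i)
                / (tail_sum d a i - t i + real (tail_sum d m i)) ^ Suc (n i)))
         sums (\<integral>y. f y \<partial>GRD d a)"
proof -
  let ?M = "exponential_product d a"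
  let ?g = "\<lambda>z. \<Prod>i=2..d. z i ^ n i * exp (t i * z i)"
  let ?p = "\<lambda>m. \<Prod>i=2..d. tail_sum d a i * fact (n i) / (tail_sum d a i - t i + real (tail_sum d m i)) ^ Suc (n i)"
  let ?s = "\<lambda>k. (r gchoose k) * (\<Sum>j=0..k. real (k choose j) * (-1) ^ (k - j) * real d powr (r - real j)
         * (\<Sum>m\<in>multi_indices d j. multinomial d j m * ?p m))"
  have mix: "mixture_const d a r = exponential_normaliser d a r"
    using d a r by (rule mixture_const_eq)
  have C: "mixture_const d a r > 0" unfolding mix using d a by (rule exponential_normaliser)
  have g: "integrable ?M ?g"
    using has_bochner_integral_exponential_product[of d a t n] a t by (simp add: has_bochner_integral_iff)
  \<comment> \<open>The factor coming from m merely lowers the tilt from t_i to t_i - mbar_i, still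
    below abar_i; hence abar_i - t_i + mbar_i in the denominators.\<close>
  have p: "(\<integral>z. ?g z * exp (- (\<Sum>i=2..d. real (tail_sum d m i) * z i)) \<partial>?M) = ?p m" for m
  proof -
    have "?g z * exp (- (\<Sum>i=2..d. real (tail_sum d m i) * z i))
      = (\<Prod>i=2..d. z i ^ n i * exp ((t i - real (tail_sum d m i)) * z i))" for z
      by (simp add: sum_negf[symmetric] exp_sum prod.distrib[symmetric] mult.assoc exp_add[symmetric] algebra_simps)
    moreover have "t i - real (tail_sum d m i) < tail_sum d a i" if "i \<in> {2..d}" for i
      using t[OF that] by (simp add: add.commute add_strict_increasing2 less_diff_eq diff_less_eq)
    ultimately show ?thesis
      using has_bochner_integral_exponential_product[of d a "\<lambda>i. t i - real (tail_sum d m i)" n] a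
      by (simp add: has_bochner_integral_iff algebra_simps)
  qed
  show "integrable (GRD d a) f"
    using sums_integral_ratio_sum_powr(1)[OF d g, of r] integrable_GRD_iff[OF d a r f] by (simp only: f_eq)
  have "(\<integral>z. ratio_sum d z powr r * ?g z \<partial>?M) = mixture_const d a r * (\<integral>y. f y \<partial>GRD d a)"
    using C integral_GRD[OF d a r f] by (simp add: f_eq mix)
  with sums_integral_ratio_sum_powr(2)[OF d g, of r]
  show sums: "?s sums (mixture_const d a r * (\<integral>y. f y \<partial>GRD d a))" by (simp only: p)
  \<comment> \<open>The factor abar_i / (abar_i + mbar_i) in the weight makes it the coefficient of
    a genuine expectation under exponential gaps of rates abar_i + mbar_i. Cancelling these positive
    rates returns to the unnormalised term.\<close>
  have w: "mixture_weight d a r j k m * (\<Prod>i=2..d. (tail_sum d a i + real (tail_sum d m i)) * fact (n i)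
                / (tail_sum d a i - t i + real (tail_sum d m i)) ^ Suc (n i))
      = inverse (mixture_const d a r) * (r gchoose k) * (real (k choose j) * (-1) ^ (k - j) * real d powr (r - real j)
         * (multinomial d j m * ?p m))" for j k m
  proof -
    have "(\<Prod>i=2..d. tail_sum d a i / (tail_sum d a i + real (tail_sum d m i)))
       * (\<Prod>i=2..d. (tail_sum d a i + real (tail_sum d m i)) * fact (n i)
                / (tail_sum d a i - t i + real (tail_sum d m i)) ^ Suc (n i)) = ?p m"
      unfolding prod.distrib[symmetric]
    proof (rule prod.cong[OF refl])
      fix i assume "i \<in> {2..d}"
      then have "tail_sum d a i + real (tail_sum d m i) > 0" using a by (simp add: add_pos_nonneg)
      then show "tail_sum d a i / (tail_sum d a i + real (tail_sum d m i)) * ((tail_sum d a i + real (tail_sum d m i)) * fact (n i)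
                / (tail_sum d a i - t i + real (tail_sum d m i)) ^ Suc (n i))
          = tail_sum d a i * fact (n i) / (tail_sum d a i - t i + real (tail_sum d m i)) ^ Suc (n i)"
        by (simp del: power_Suc)
    qed
    then show ?thesis unfolding mixture_weight_def by (simp only: mult.assoc)
  qed
  have "(\<lambda>k. inverse (mixture_const d a r) * ?s k) sums (inverse (mixture_const d a r) * (mixture_const d a r * (\<integral>y. f y \<partial>GRD d a)))"
    by (rule sums_mult[OF sums])
  moreover have "inverse (mixture_const d a r) * (mixture_const d a r * (\<integral>y. f y \<partial>GRD d a)) = (\<integral>y. f y \<partial>GRD d a)"
    using C by simp
  ultimately show "(\<lambda>k. \<Sum>j=0..k. \<Sum>m\<in>multi_indices d j. mixture_weight d a r j k m
           * (\<Prod>i=2..d. (tail_sum d a i + real (tail_sum d m i)) * fact (n i)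
                / (tail_sum d a i - t i + real (tail_sum d m i)) ^ Suc (n i)))
         sums (\<integral>y. f y \<partial>GRD d a)"
    unfolding w by (simp add: sum_distrib_left mult.assoc)
qed

theorem corollary14:
  fixes d :: nat and a :: "nat \<Rightarrow> real" and r :: real
  assumes "d \<ge> 2"
    and "\<And>k. k \<in> {2..d} \<Longrightarrow> tail_sum d a k > 0"
    and "r = - tail_sum d a 1"
  shows
    "integrable (GRD d (a(1 := a 1 + r))) (\<lambda>y. 1 / y 1 powr r) \<and>
     (\<lambda>k. (r gchoose k) * (\<Sum>j=0..k. real (k choose j) * (-1) ^ (k - j) * real d powr (r - real j)
         * (\<Sum>m\<in>multi_indices d j. multinomial d j m
             * (\<Prod>i=2..d. tail_sum d a i / (tail_sum d a i + real (tail_sum d m i))))))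
       sums mixture_const d a r \<and>
     (\<forall>t :: nat \<Rightarrow> real. (\<forall>i\<in>{2..d}. t i < tail_sum d a i) \<longrightarrow>
       integrable (GRD d a) (\<lambda>y. exp (\<Sum>i=2..d. t i * log_gap i y)) \<and>
       (\<lambda>k. \<Sum>j=0..k. \<Sum>m\<in>multi_indices d j. mixture_weight d a r j k m
           * (\<Prod>i=2..d. (tail_sum d a i + real (tail_sum d m i))
                        / (tail_sum d a i - t i + real (tail_sum d m i))))
         sums prob_space.expectation (GRD d a) (\<lambda>y. exp (\<Sum>i=2..d. t i * log_gap i y))) \<and>
     (\<forall>n :: nat \<Rightarrow> nat.
       integrable (GRD d a) (\<lambda>y. \<Prod>i=2..d. log_gap i y ^ n i) \<and>
       (\<lambda>k. \<Sum>j=0..k. \<Sum>m\<in>multi_indices d j. mixture_weight d a r j k m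
           * (\<Prod>i=2..d. fact (n i) / (tail_sum d a i + real (tail_sum d m i)) ^ n i))
         sums prob_space.expectation (GRD d a) (\<lambda>y. \<Prod>i=2..d. log_gap i y ^ n i))"
proof -
  have d: "d \<ge> 1" using assms(1) by simp
  note a = assms(2) and r = assms(3)
  have log_gap_measurable: "log_gap i \<in> borel_measurable (Pi\<^sub>M {1..d} (\<lambda>_. borel))" if "i \<in> {2..d}" for i
  proof -
    have "i - 1 \<in> {1..d}" "i \<in> {1..d}" using that by auto
    then show ?thesis
      unfolding log_gap_def[abs_def]
      by (intro borel_measurable_diff borel_measurable_ln measurable_component_singleton)
  qed
  \<comment> \<open>With f = 1 the unnormalised series sums to C times this total mass.\<close>
  have one: "(\<integral>y. 1 \<partial>GRD d a) = (1 :: real)"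
    using integral_GRD[OF d a r, of "\<lambda>_. 1"] exponential_normaliser(2)[OF d a, of r]
    by (simp add: exponential_normaliser_def)
  have "integrable (GRD d (a(1 := a 1 + r))) (\<lambda>y. 1 / y 1 powr r)"
    using d a r by (rule integrable_GRD_first_powr)
  moreover have "(\<lambda>k. (r gchoose k) * (\<Sum>j=0..k. real (k choose j) * (-1) ^ (k - j) * real d powr (r - real j)
         * (\<Sum>m\<in>multi_indices d j. multinomial d j m
             * (\<Prod>i=2..d. tail_sum d a i / (tail_sum d a i + real (tail_sum d m i))))))
       sums mixture_const d a r"
  proof -
    have "(\<lambda>k. (r gchoose k) * (\<Sum>j=0..k. real (k choose j) * (-1) ^ (k - j) * real d powr (r - real j)
         * (\<Sum>m\<in>multi_indices d j. multinomial d j m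
             * (\<Prod>i=2..d. tail_sum d a i * fact 0 / (tail_sum d a i - 0 + real (tail_sum d m i)) ^ Suc 0))))
       sums (mixture_const d a r * (\<integral>y. 1 \<partial>GRD d a))"
      by (rule GRD_log_gap_expectation(2)[where n="\<lambda>_. 0" and t="\<lambda>_. 0" and f="\<lambda>_. 1"])
         (simp_all add: d a r[symmetric] del: One_nat_def)
    then show ?thesis
      by (simp only: one fact_0 power_Suc power_0 diff_zero mult_1_right)
  qed
  moreover have "integrable (GRD d a) (\<lambda>y. exp (\<Sum>i=2..d. t i * log_gap i y)) \<and>
       (\<lambda>k. \<Sum>j=0..k. \<Sum>m\<in>multi_indices d j. mixture_weight d a r j k m
           * (\<Prod>i=2..d. (tail_sum d a i + real (tail_sum d m i))
                        / (tail_sum d a i - t i + real (tail_sum d m i))))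
         sums prob_space.expectation (GRD d a) (\<lambda>y. exp (\<Sum>i=2..d. t i * log_gap i y))"
    if t: "\<forall>i\<in>{2..d}. t i < tail_sum d a i" for t :: "nat \<Rightarrow> real"
  proof -
    have f: "(\<lambda>y. exp (\<Sum>i=2..d. t i * log_gap i y)) \<in> borel_measurable (Pi\<^sub>M {1..d} (\<lambda>_. borel))"
      by (rule measurable_compose[OF _ borel_measurable_exp])
         (intro borel_measurable_sum borel_measurable_times borel_measurable_const log_gap_measurable)
    have f_eq: "exp (\<Sum>i=2..d. t i * log_gap i (rank_point d z)) = (\<Prod>i=2..d. z i ^ 0 * exp (t i * z i))" for z
      by (simp add: log_gap_rank_point exp_sum)
    have t': "t i < tail_sum d a i" if "i \<in> {2..d}" for i using t that by blast
    have "integrable (GRD d a) (\<lambda>y. exp (\<Sum>i=2..d. t i * log_gap i y))"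
      using d a r t' f f_eq by (rule GRD_log_gap_expectation(1))
    moreover have "(\<lambda>k. \<Sum>j=0..k. \<Sum>m\<in>multi_indices d j. mixture_weight d a r j k m
           * (\<Prod>i=2..d. (tail_sum d a i + real (tail_sum d m i)) * fact 0
                / (tail_sum d a i - t i + real (tail_sum d m i)) ^ Suc 0))
         sums (\<integral>y. exp (\<Sum>i=2..d. t i * log_gap i y) \<partial>GRD d a)"
      using d a r t' f f_eq by (rule GRD_log_gap_expectation(3))
    ultimately show ?thesis
      by (simp only: fact_0 power_Suc power_0 mult_1_right simp_thms)
  qed
  moreover have "integrable (GRD d a) (\<lambda>y. \<Prod>i=2..d. log_gap i y ^ n i) \<and>
       (\<lambda>k. \<Sum>j=0..k. \<Sum>m\<in>multi_indices d j. mixture_weight d a r j k m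
           * (\<Prod>i=2..d. fact (n i) / (tail_sum d a i + real (tail_sum d m i)) ^ n i))
         sums prob_space.expectation (GRD d a) (\<lambda>y. \<Prod>i=2..d. log_gap i y ^ n i)" for n :: "nat \<Rightarrow> nat"
  proof -
    have f: "(\<lambda>y. \<Prod>i=2..d. log_gap i y ^ n i) \<in> borel_measurable (Pi\<^sub>M {1..d} (\<lambda>_. borel))"
      by (intro borel_measurable_prod borel_measurable_power log_gap_measurable)
    have f_eq: "(\<Prod>i=2..d. log_gap i (rank_point d z) ^ n i) = (\<Prod>i=2..d. z i ^ n i * exp (0 * z i))" for z
      by (simp add: log_gap_rank_point)
    \<comment> \<open>For t = 0 one factor abar_i + mbar_i cancels, which lowers the power from n_i
      + 1 to n_i.\<close>
    have "(\<Prod>i=2..d. (tail_sum d a i + real (tail_sum d m i)) * fact (n i)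
                / (tail_sum d a i - 0 + real (tail_sum d m i)) ^ Suc (n i))
       = (\<Prod>i=2..d. fact (n i) / (tail_sum d a i + real (tail_sum d m i)) ^ n i)" for m
    proof (rule prod.cong[OF refl])
      fix i assume "i \<in> {2..d}"
      then have "tail_sum d a i + real (tail_sum d m i) > 0" using a by (simp add: add_pos_nonneg)
      then show "(tail_sum d a i + real (tail_sum d m i)) * fact (n i)
                / (tail_sum d a i - 0 + real (tail_sum d m i)) ^ Suc (n i)
         = fact (n i) / (tail_sum d a i + real (tail_sum d m i)) ^ n i" by simp
    qed
    \<comment> \<open>Positivity of the rates is supplied twice: as such, and as the condition t_i <
      abar_i for t = 0.\<close>
    moreover have "integrable (GRD d a) (\<lambda>y. \<Prod>i=2..d. log_gap i y ^ n i)"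
      using d a r a f f_eq by (rule GRD_log_gap_expectation(1))
    moreover have "(\<lambda>k. \<Sum>j=0..k. \<Sum>m\<in>multi_indices d j. mixture_weight d a r j k m
           * (\<Prod>i=2..d. (tail_sum d a i + real (tail_sum d m i)) * fact (n i)
                / (tail_sum d a i - 0 + real (tail_sum d m i)) ^ Suc (n i)))
         sums (\<integral>y. (\<Prod>i=2..d. log_gap i y ^ n i) \<partial>GRD d a)"
      using d a r a f f_eq by (rule GRD_log_gap_expectation(3))
    ultimately show ?thesis
      by (simp only: simp_thms)
  qed
  ultimately show ?thesis by blast
qed

end
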